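(* Let $n\ge 1$, let $A=A_1\times\cdots\times A_n$ and $B=B_1\times\cdots\times B_n$ be products of finite sets, and let $\alpha_0,\alpha_1\in\mathrm{Prob}^A$, $\beta_0,\beta_1\in\mathrm{Prob}^B$. Consider the bit-commitment based coin-flipping protocol with parameters $(\alpha_0,\alpha_1,\beta_0,\beta_1)$. For each $c\in\{0,1\}$, the maximum probability $P_{\mathrm{B},c}^*$ with which cheating Bob can force honest Alice to accept outcome $c$ is given by the optimal objective function value of the following convex optimization problem: $$P_{\mathrm{B},c}^* = \max\left\{ \frac12 \sum_{a\in\{0,1\}} \mathrm{F}\left( (\alpha_a\otimes \mathrm{I}_B)^{\mathrm T} p_n,\ \beta_{a\oplus c}\right) : (p_1,\ldots,p_n)\in\mathcal{P}_{\mathrm B}\right\},$$ where the arguments of the fidelity functions are probability distributions over $B$.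
   Context: Notation. For a finite set $S$: $\mathbb{R}_+^S$ is the set of nonnegative real vectors indexed by $S$; $\mathrm{Prob}^S$ is the set of probability vectors indexed by $S$; $e_x$ ($x\in S$) are the standard basis vectors; $e_S$ is the all-ones vector. $\oplus$ is XOR of bits. For $p,q\in\mathbb{R}_+^S$ the fidelity is $\mathrm{F}(p,q)=\left(\sum_{x\in S}\sqrt{p_x}\sqrt{q_x}\right)^2$. For a vector $v\in\mathbb{R}^{S\times T}$, the partial trace over $S$ is $\mathrm{Tr}_S(v)\in\mathbb{R}^T$, $[\mathrm{Tr}_S(v)]_t=\sum_{s\in S}v_{s,t}$. $\mathrm{I}_B$ is the identity on $\mathbb{R}^B$, and for $p_n$ indexed by $A_1\times B_1\times\cdots\times A_n\times B_n\cong A\times B$, $[(\alpha_a\otimes\mathrm{I}_B)^{\mathrm T}p_n]_y=\sum_{x\in A}\alpha_{a,x}[p_n]_{x,y}$. Equalities between vectors indexed by products of sets are understood by matching coordinates by label. Bob's cheating polytope $\mathcal{P}_{\mathrm B}$ is the set of all $(p_1,\ldots,p_n)$ with $p_j\in\mathbb{R}_+^{A_1\times B_1\times\cdots\times A_j\times B_j}$ for $j=1,\ldots,n$, $\mathrm{Tr}_{B_1}(p_1)=e_{A_1}$, and $\mathrm{Tr}_{B_j}(p_j)=p_{j-1}\otimes e_{A_j}$ for $j=2,\ldots,n$. Protocol. Let $A'=A$ and $B'=B$ be copies, and $A_0=A_0'=B_0=B_0'=\{0,1\}$; a set is used as a label for the quantum register with state space $\mathbb{C}^{\text{set}}$. Put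 $\psi_a=\sum_{x\in A}\sqrt{\alpha_{a,x}}\,e_x\otimes e_x\in\mathbb{C}^A\otimes\mathbb{C}^{A'}$, $\psi=\sum_{a\in\{0,1\}}\frac{1}{\sqrt2}e_a\otimes e_a\otimes\psi_a\in\mathbb{C}^{A_0}\otimes\mathbb{C}^{A_0'}\otimes\mathbb{C}^A\otimes\mathbb{C}^{A'}$, $\phi_b=\sum_{y\in B}\sqrt{\beta_{b,y}}\,e_y\otimes e_y\in\mathbb{C}^B\otimes\mathbb{C}^{B'}$, $\phi=\sum_{b\in\{0,1\}}\frac{1}{\sqrt2}e_b\otimes e_b\otimes\phi_b\in\mathbb{C}^{B_0}\otimes\mathbb{C}^{B_0'}\otimes\mathbb{C}^B\otimes\mathbb{C}^{B'}$. Alice prepares $\psi$ and Bob prepares $\phi$. For $i=1,\ldots,n$: Alice sends $\mathbb{C}^{A_i}$ to Bob, who replies with $\mathbb{C}^{B_i}$. Then Alice sends $\mathbb{C}^{A_0'}$ and $\mathbb{C}^{A'}$ to Bob, and then Bob sends $\mathbb{C}^{B_0'}$ and $\mathbb{C}^{B'}$ to Alice. Finally Alice measures registers $A_0,B_0',B,B'$ with the POVM $(\Pi_{\mathrm A,0},\Pi_{\mathrm A,1},\Pi_{\mathrm A,\mathrm{abort}})$, where $\Pi_{\mathrm A,c}=\sum_{b\in\{0,1\}}e_{b\oplus c}e_{b\oplus c}^*\otimes e_be_b^*\otimes\phi_b\phi_b^*$ and $\Pi_{\mathrm A,\mathrm{abort}}=\mathrm I-\Pi_{\mathrm A,0}-\Pi_{\mathrm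 A,1}$; Bob measures registers $B_0,A_0',A,A'$ with $(\Pi_{\mathrm B,0},\Pi_{\mathrm B,1},\Pi_{\mathrm B,\mathrm{abort}})$, where $\Pi_{\mathrm B,c}=\sum_{a\in\{0,1\}}e_{a\oplus c}e_{a\oplus c}^*\otimes e_ae_a^*\otimes\psi_a\psi_a^*$ and $\Pi_{\mathrm B,\mathrm{abort}}=\mathrm I-\Pi_{\mathrm B,0}-\Pi_{\mathrm B,1}$. The measurement outcome is the party's output. Cheating. A cheating party may use a private workspace of arbitrary finite dimension, an arbitrary initial state (unentangled with the honest party), arbitrary quantum operations on the qubits in its possession between messages, and an arbitrary final measurement; the only restriction is that its messages have the dimensions prescribed by the protocol. The other party follows the protocol. $P_{\mathrm B,c}^*$ is the supremum, over all cheating strategies of Bob, of the probability that honest Alice outputs $c$. *)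

theory Defs
  imports "HOL-Analysis.Analysis" "HOL-Library.Z2"
begin

section \<open>Matrices indexed by label sets\<close>

text \<open>
  The space of linear operators on \<open>\<complex>\<^sup>S\<close>, for a finite label set \<open>S\<close>, is represented by the
  functions of two labels that vanish outside \<open>S \<times> S\<close>. Label sets (rather than index types)
  are needed because the workspace dimensions are quantified over inside the statement.
  Tensor products of registers are products of label sets.
\<close>

type_synonym 'i cmat = "'i \<Rightarrow> 'i \<Rightarrow> complex"

definition mats :: "'i set \<Rightarrow> 'i cmat set" where
  "mats S = {X. \<forall>i j. i \<notin> S \<or> j \<notin> S \<longrightarrow> X i j = 0}"

definition id_mat :: "'i set \<Rightarrow> 'i cmat" where
  "id_mat S = (\<lambda>i j. if i = j \<and> i \<in> S then 1 else 0)"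

definition trace_on :: "'i set \<Rightarrow> 'i cmat \<Rightarrow> complex" where
  "trace_on S X = (\<Sum>i\<in>S. X i i)"

definition mat_prod :: "'i set \<Rightarrow> 'i cmat \<Rightarrow> 'i cmat \<Rightarrow> 'i cmat" where
  "mat_prod S X Y = (\<lambda>i j. \<Sum>k\<in>S. X i k * Y k j)"

definition tensor :: "'i cmat \<Rightarrow> 'j cmat \<Rightarrow> ('i \<times> 'j) cmat" where
  "tensor X Y = (\<lambda>(i, k) (j, l). X i j * Y k l)"

definition basis_vec :: "'i \<Rightarrow> 'i \<Rightarrow> complex" where
  "basis_vec x = (\<lambda>u. if u = x then 1 else 0)"

text \<open>The rank-one operator \<open>v v\<^sup>*\<close>.\<close>

definition outer :: "('i \<Rightarrow> complex) \<Rightarrow> 'i cmat" where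
  "outer v = (\<lambda>i j. v i * cnj (v j))"

definition psd_on :: "'i set \<Rightarrow> 'i cmat \<Rightarrow> bool" where
  "psd_on S X \<longleftrightarrow> X \<in> mats S \<and>
     (\<forall>v. (\<Sum>i\<in>S. \<Sum>j\<in>S. cnj (v i) * X i j * v j) \<in> \<real>\<^sub>\<ge>\<^sub>0)"

definition density_on :: "'i set \<Rightarrow> 'i cmat \<Rightarrow> bool" where
  "density_on S X \<longleftrightarrow> psd_on S X \<and> trace_on S X = 1"

text \<open>
  \<open>ampliate \<Phi>\<close> is \<open>id \<otimes> \<Phi>\<close>: the map \<open>\<Phi>\<close> is applied to every block of the
  block matrix \<open>X\<close>, the first label component being the untouched register.
\<close>

definition ampliate :: "('s cmat \<Rightarrow> 't cmat) \<Rightarrow> ('e \<times> 's) cmat \<Rightarrow> ('e \<times> 't) cmat" where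
  "ampliate \<Phi> X = (\<lambda>(e, t) (e', t'). \<Phi> (\<lambda>s s'. X (e, s) (e', s')) t t')"

definition linear_on_mats :: "'s set \<Rightarrow> 't set \<Rightarrow> ('s cmat \<Rightarrow> 't cmat) \<Rightarrow> bool" where
  "linear_on_mats S T \<Phi> \<longleftrightarrow> (\<forall>X\<in>mats S. \<Phi> X \<in> mats T) \<and>
     (\<forall>X\<in>mats S. \<forall>Y\<in>mats S. \<forall>z.
        \<Phi> (\<lambda>i j. z * X i j + Y i j) = (\<lambda>i j. z * \<Phi> X i j + \<Phi> Y i j))"

definition completely_positive :: "'s set \<Rightarrow> 't set \<Rightarrow> ('s cmat \<Rightarrow> 't cmat) \<Rightarrow> bool" where
  "completely_positive S T \<Phi> \<longleftrightarrow>
     (\<forall>k::nat. \<forall>X. psd_on ({..<k} \<times> S) X \<longrightarrow> psd_on ({..<k} \<times> T) (ampliate \<Phi> X))"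

text \<open>Quantum operations (completely positive trace-preserving maps) from \<open>\<complex>\<^sup>S\<close> to \<open>\<complex>\<^sup>T\<close>.\<close>

definition quantum_op :: "'s set \<Rightarrow> 't set \<Rightarrow> ('s cmat \<Rightarrow> 't cmat) \<Rightarrow> bool" where
  "quantum_op S T \<Phi> \<longleftrightarrow> linear_on_mats S T \<Phi> \<and> completely_positive S T \<Phi> \<and>
     (\<forall>X\<in>mats S. trace_on T (\<Phi> X) = trace_on S X)"

definition povm :: "'i set \<Rightarrow> nat \<Rightarrow> (nat \<Rightarrow> 'i cmat) \<Rightarrow> bool" where
  "povm S m M \<longleftrightarrow> (\<forall>k<m. psd_on S (M k)) \<and> (\<lambda>i j. \<Sum>k<m. M k i j) = id_mat S"

text \<open>
  Regrouping of registers: \<open>f\<close> maps the new label set \<open>S\<close> bijectively to the old one.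
\<close>

definition relabel :: "'s set \<Rightarrow> ('s \<Rightarrow> 't) \<Rightarrow> 't cmat \<Rightarrow> 's cmat" where
  "relabel S f X = (\<lambda>i j. if i \<in> S \<and> j \<in> S then X (f i) (f j) else 0)"

section \<open>Probability vectors and fidelity\<close>

definition prob_vec :: "'i set \<Rightarrow> ('i \<Rightarrow> real) \<Rightarrow> bool" where
  "prob_vec S p \<longleftrightarrow> (\<forall>x\<in>S. 0 \<le> p x) \<and> (\<Sum>x\<in>S. p x) = 1"

definition fidelity :: "'i set \<Rightarrow> ('i \<Rightarrow> real) \<Rightarrow> ('i \<Rightarrow> real) \<Rightarrow> real" where
  "fidelity S p q = (\<Sum>x\<in>S. sqrt (p x) * sqrt (q x))\<^sup>2"

section \<open>Honest Alice\<close>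

text \<open>
  Elements of \<open>A\<^sub>1 \<times> \<dots> \<times> A\<^sub>n\<close> are functions in \<open>Pi\<^sub>E {1..n} A\<close>. Bits have type \<^typ>\<open>bit\<close>,
  the integers mod 2, so that \<open>+\<close> on bits is XOR.
\<close>

text \<open>
  \<open>purification S p\<close> is \<open>\<Sum>\<^sub>x \<surd>p\<^sub>x e\<^sub>x \<otimes> e\<^sub>x\<close>. The vectors \<open>\<psi>\<^sub>a\<close> and \<open>\<phi>\<^sub>b\<close> of the protocol are
  \<open>purification (Pi\<^sub>E {1..n} A) (\<alpha> a)\<close> and \<open>purification (Pi\<^sub>E {1..n} B) (\<beta> b)\<close>.
\<close>

definition purification :: "'i set \<Rightarrow> ('i \<Rightarrow> real) \<Rightarrow> 'i \<times> 'i \<Rightarrow> complex" where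
  "purification S p = (\<lambda>(u, v). \<Sum>x\<in>S. complex_of_real (sqrt (p x)) * basis_vec x u * basis_vec x v)"

definition alice_psi ::
  "nat \<Rightarrow> (nat \<Rightarrow> 'a set) \<Rightarrow> (bit \<Rightarrow> (nat \<Rightarrow> 'a) \<Rightarrow> real)
    \<Rightarrow> bit \<times> bit \<times> (nat \<Rightarrow> 'a) \<times> (nat \<Rightarrow> 'a) \<Rightarrow> complex" where
  "alice_psi n A \<alpha> = (\<lambda>(a0, a0', x, x').
     \<Sum>a\<in>{0, 1}. complex_of_real (1 / sqrt 2) * basis_vec a a0 * basis_vec a a0' *
       purification (Pi\<^sub>E {1..n} A) (\<alpha> a) (x, x'))"

text \<open>\<open>\<Pi>\<^bsub>A,c\<^esub>\<close>, acting on Alice's final registers \<open>A\<^sub>0, B\<^sub>0', B, B'\<close>.\<close>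

definition alice_proj ::
  "nat \<Rightarrow> (nat \<Rightarrow> 'b set) \<Rightarrow> (bit \<Rightarrow> (nat \<Rightarrow> 'b) \<Rightarrow> real) \<Rightarrow> bit
    \<Rightarrow> (bit \<times> bit \<times> (nat \<Rightarrow> 'b) \<times> (nat \<Rightarrow> 'b)) cmat" where
  "alice_proj n B \<beta> c = (\<lambda>i j. \<Sum>b\<in>{0, 1}.
     tensor (outer (basis_vec (b + c)))
       (tensor (outer (basis_vec b)) (outer (purification (Pi\<^sub>E {1..n} B) (\<beta> b)))) i j)"

section \<open>Cheating Bob\<close>

text \<open>
  Bob's workspace after round \<open>j\<close> is \<open>\<complex>\<^sup>d\<close> with \<open>d = wdim j\<close> (\<open>j = 0\<close>: before the protocol;
  \<open>j = n + 1\<close>: after his last message); the dimension may change from round to round, as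
  messages are received and sent. Bob's registers are ordered (workspace, received message)
  before each operation and (message to be sent, workspace) after it.
\<close>

record ('a, 'b) bob_strategy =
  wdim :: "nat \<Rightarrow> nat"
  init_state :: "nat cmat"
  round_op :: "nat \<Rightarrow> (nat \<times> 'a) cmat \<Rightarrow> ('b \<times> nat) cmat"
  last_op :: "(nat \<times> bit \<times> (nat \<Rightarrow> 'a)) cmat \<Rightarrow> ((bit \<times> (nat \<Rightarrow> 'b)) \<times> nat) cmat"
  num_outcomes :: nat
  final_meas :: "nat \<Rightarrow> nat cmat"

abbreviation wspace :: "('a, 'b) bob_strategy \<Rightarrow> nat \<Rightarrow> nat set" where
  "wspace s j \<equiv> {..<wdim s j}"

definition valid_strategy ::
  "nat \<Rightarrow> (nat \<Rightarrow> 'a set) \<Rightarrow> (nat \<Rightarrow> 'b set) \<Rightarrow> ('a, 'b) bob_strategy \<Rightarrow> bool" where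
  "valid_strategy n A B s \<longleftrightarrow>
     density_on (wspace s 0) (init_state s) \<and>
     (\<forall>j\<in>{1..n}. quantum_op (wspace s (j - 1) \<times> A j) (B j \<times> wspace s j) (round_op s j)) \<and>
     quantum_op (wspace s n \<times> UNIV \<times> Pi\<^sub>E {1..n} A)
       ((UNIV \<times> Pi\<^sub>E {1..n} B) \<times> wspace s (n + 1)) (last_op s) \<and>
     povm (wspace s (n + 1)) (num_outcomes s) (final_meas s)"

text \<open>
  \<open>alice_regs n A B i k\<close> labels Alice's registers \<open>A\<^sub>0, A\<^sub>0', A\<^bsub>i+1\<^esub> \<times> \<dots> \<times> A\<^sub>n, A', B\<^sub>1 \<times> \<dots> \<times> B\<^sub>k\<close>
  when she has sent \<open>i\<close> and received \<open>k\<close> of the first \<open>n\<close> messages.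
\<close>

definition alice_regs ::
  "nat \<Rightarrow> (nat \<Rightarrow> 'a set) \<Rightarrow> (nat \<Rightarrow> 'b set) \<Rightarrow> nat \<Rightarrow> nat
    \<Rightarrow> (bit \<times> bit \<times> (nat \<Rightarrow> 'a) \<times> (nat \<Rightarrow> 'a) \<times> (nat \<Rightarrow> 'b)) set" where
  "alice_regs n A B i k = UNIV \<times> UNIV \<times> Pi\<^sub>E {i<..n} A \<times> Pi\<^sub>E {1..n} A \<times> Pi\<^sub>E {1..k} B"

text \<open>
  The joint density operator of Alice and Bob after \<open>j\<close> rounds. Initially, Alice's
  register of received messages is the empty product (one label), and Bob's state is unentangled
  with hers.
\<close>

primrec joint_state ::
  "nat \<Rightarrow> (nat \<Rightarrow> 'a set) \<Rightarrow> (nat \<Rightarrow> 'b set) \<Rightarrow> (bit \<Rightarrow> (nat \<Rightarrow> 'a) \<Rightarrow> real)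
    \<Rightarrow> ('a, 'b) bob_strategy \<Rightarrow> nat
    \<Rightarrow> ((bit \<times> bit \<times> (nat \<Rightarrow> 'a) \<times> (nat \<Rightarrow> 'a) \<times> (nat \<Rightarrow> 'b)) \<times> nat) cmat" where
  "joint_state n A B \<alpha> s 0 =
     tensor (relabel (alice_regs n A B 0 0) (\<lambda>(a0, a0', x, x', y). (a0, a0', x, x'))
               (outer (alice_psi n A \<alpha>)))
            (init_state s)"
| "joint_state n A B \<alpha> s (Suc j) =
     (let sent = relabel (alice_regs n A B (Suc j) j \<times> wspace s j \<times> A (Suc j))
                   (\<lambda>((a0, a0', x, x', y), (w, u)). ((a0, a0', x(Suc j := u), x', y), w))
                   (joint_state n A B \<alpha> s j);
          replied = ampliate (round_op s (Suc j)) sent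
      in relabel (alice_regs n A B (Suc j) (Suc j) \<times> wspace s (Suc j))
           (\<lambda>((a0, a0', x, x', y), w). ((a0, a0', x, x', restrict y {1..j}), (y (Suc j), w)))
           replied)"

definition final_regs ::
  "nat \<Rightarrow> (nat \<Rightarrow> 'b set) \<Rightarrow> (bit \<times> bit \<times> (nat \<Rightarrow> 'b) \<times> (nat \<Rightarrow> 'b)) set" where
  "final_regs n B = UNIV \<times> UNIV \<times> Pi\<^sub>E {1..n} B \<times> Pi\<^sub>E {1..n} B"

text \<open>
  The exchange of the commitment registers. Before it, Alice's \<open>A\<close>-register is an
  empty product, whose only label is \<open>\<lambda>_. undefined\<close>.
\<close>

definition final_state ::
  "nat \<Rightarrow> (nat \<Rightarrow> 'a set) \<Rightarrow> (nat \<Rightarrow> 'b set) \<Rightarrow> (bit \<Rightarrow> (nat \<Rightarrow> 'a) \<Rightarrow> real)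
    \<Rightarrow> ('a, 'b) bob_strategy \<Rightarrow> ((bit \<times> bit \<times> (nat \<Rightarrow> 'b) \<times> (nat \<Rightarrow> 'b)) \<times> nat) cmat" where
  "final_state n A B \<alpha> s =
     (let sent = relabel ((UNIV \<times> Pi\<^sub>E {1..n} B) \<times> wspace s n \<times> UNIV \<times> Pi\<^sub>E {1..n} A)
                   (\<lambda>((a0, y), (w, a0', x')). ((a0, a0', \<lambda>_. undefined, x', y), w))
                   (joint_state n A B \<alpha> s n);
          replied = ampliate (last_op s) sent
      in relabel (final_regs n B \<times> wspace s (n + 1))
           (\<lambda>((a0, b0', y, y'), w). ((a0, y), ((b0', y'), w)))
           replied)"

text \<open>
  The probability that Alice outputs \<open>c\<close>, summed over the outcomes of Bob's own final measurement.
  Each summand is the trace of a product of two positive semidefinite matrices, so taking its real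
  part loses nothing.
\<close>

definition accept_prob ::
  "nat \<Rightarrow> (nat \<Rightarrow> 'a set) \<Rightarrow> (nat \<Rightarrow> 'b set) \<Rightarrow> (bit \<Rightarrow> (nat \<Rightarrow> 'a) \<Rightarrow> real)
    \<Rightarrow> (bit \<Rightarrow> (nat \<Rightarrow> 'b) \<Rightarrow> real) \<Rightarrow> bit \<Rightarrow> ('a, 'b) bob_strategy \<Rightarrow> real" where
  "accept_prob n A B \<alpha> \<beta> c s =
     (let L = final_regs n B \<times> wspace s (n + 1)
      in \<Sum>k<num_outcomes s.
           Re (trace_on L (mat_prod L (tensor (alice_proj n B \<beta> c) (final_meas s k))
                                      (final_state n A B \<alpha> s))))"

text \<open>
  The supremum is over a nonempty set of probabilities, so the supremum in \<^typ>\<open>real\<close> is the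
  intended one.
\<close>

definition bob_cheat_prob ::
  "nat \<Rightarrow> (nat \<Rightarrow> 'a set) \<Rightarrow> (nat \<Rightarrow> 'b set) \<Rightarrow> (bit \<Rightarrow> (nat \<Rightarrow> 'a) \<Rightarrow> real)
    \<Rightarrow> (bit \<Rightarrow> (nat \<Rightarrow> 'b) \<Rightarrow> real) \<Rightarrow> bit \<Rightarrow> real" where
  "bob_cheat_prob n A B \<alpha> \<beta> c =
     (SUP s \<in> {s. valid_strategy n A B s}. accept_prob n A B \<alpha> \<beta> c s)"

section \<open>The optimization problem\<close>

text \<open>
  \<open>p j x y\<close> is the entry of \<open>p\<^sub>j\<close> at \<open>x \<in> A\<^sub>1 \<times> \<dots> \<times> A\<^sub>j\<close>, \<open>y \<in> B\<^sub>1 \<times> \<dots> \<times> B\<^sub>j\<close>; all other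
  values of \<open>p\<close> are irrelevant.
\<close>

type_synonym ('a, 'b) cheat_vec = "nat \<Rightarrow> (nat \<Rightarrow> 'a) \<Rightarrow> (nat \<Rightarrow> 'b) \<Rightarrow> real"

definition bob_polytope ::
  "nat \<Rightarrow> (nat \<Rightarrow> 'a set) \<Rightarrow> (nat \<Rightarrow> 'b set) \<Rightarrow> ('a, 'b) cheat_vec set" where
  "bob_polytope n A B = {p.
     (\<forall>j\<in>{1..n}. \<forall>x\<in>Pi\<^sub>E {1..j} A. \<forall>y\<in>Pi\<^sub>E {1..j} B. 0 \<le> p j x y) \<and>
     (\<forall>x\<in>Pi\<^sub>E {1..1} A. (\<Sum>b\<in>B 1. p 1 x ((\<lambda>_. undefined)(1 := b))) = 1) \<and>
     (\<forall>j\<in>{2..n}. \<forall>x\<in>Pi\<^sub>E {1..j} A. \<forall>y\<in>Pi\<^sub>E {1..j-1} B.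
        (\<Sum>b\<in>B j. p j x (y(j := b))) = p (j - 1) (restrict x {1..j-1}) y)}"

text \<open>\<open>(\<alpha>\<^sub>a \<otimes> I\<^sub>B)\<^sup>T p\<^sub>n\<close>\<close>

definition reduced_vec ::
  "nat \<Rightarrow> (nat \<Rightarrow> 'a set) \<Rightarrow> ((nat \<Rightarrow> 'a) \<Rightarrow> real) \<Rightarrow> ('a, 'b) cheat_vec \<Rightarrow> (nat \<Rightarrow> 'b) \<Rightarrow> real" where
  "reduced_vec n A \<alpha>a p = (\<lambda>y. \<Sum>x\<in>Pi\<^sub>E {1..n} A. \<alpha>a x * p n x y)"

definition bob_objective ::
  "nat \<Rightarrow> (nat \<Rightarrow> 'a set) \<Rightarrow> (nat \<Rightarrow> 'b set) \<Rightarrow> (bit \<Rightarrow> (nat \<Rightarrow> 'a) \<Rightarrow> real)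
    \<Rightarrow> (bit \<Rightarrow> (nat \<Rightarrow> 'b) \<Rightarrow> real) \<Rightarrow> bit \<Rightarrow> ('a, 'b) cheat_vec \<Rightarrow> real" where
  "bob_objective n A B \<alpha> \<beta> c p =
     1 / 2 * (\<Sum>a\<in>{0, 1}. fidelity (Pi\<^sub>E {1..n} B) (reduced_vec n A (\<alpha> a) p) (\<beta> (a + c)))"

text \<open>
  Maximizing \<open>f\<close> over \<open>P\<close> is a convex optimization problem: \<open>P\<close> is convex and \<open>f\<close> is concave
  on \<open>P\<close> (the function type carries no vector space instance, so the library's \<open>convex\<close> does
  not apply).
\<close>

definition convex_maximization ::
  "('a, 'b) cheat_vec set \<Rightarrow> (('a, 'b) cheat_vec \<Rightarrow> real) \<Rightarrow> bool" where
  "convex_maximization P f \<longleftrightarrow> (\<forall>p\<in>P. \<forall>q\<in>P. \<forall>t\<in>{0..1}.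
     (let r = (\<lambda>j x y. (1 - t) * p j x y + t * q j x y)
      in r \<in> P \<and> (1 - t) * f p + t * f q \<le> f r))"

end

theory Submission
  imports Defs
begin

text \<open>
  The value of the game is squeezed between two bounds that meet because Alice keeps copies of
  everything she sends, in the registers \<open>A\<^sub>0'\<close> and \<open>A'\<close>, until the commitment is opened.

  Upper bound. Because of these copies, Alice's messages look classical to Bob during the first
  \<open>n\<close> rounds. Let \<open>p\<^sub>j(x,y)\<close> be the trace of Bob's unnormalised state after round \<open>j\<close> when he has
  received the basis states \<open>x\<close> and his replies are measured as \<open>y\<close>. It does not depend on
  \<open>\<alpha>\<close>, and that Bob's operation in round \<open>j\<close> preserves the trace is exactly the \<open>j\<close>-th
  constraint of the polytope (\<open>bob_weight_in_polytope\<close>, \<open>joint_state_block\<close>). At the end Alice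
  projects onto \<open>\<phi>\<^sub>b\<close> with \<open>b = a \<oplus> c\<close>. An off-diagonal entry of a positive semidefinite matrix is
  at most the geometric mean of the two diagonal entries, so the projection succeeds at
  most with the fidelity of \<open>\<beta>\<^sub>b\<close> with the diagonal of Alice's \<open>B\<close>-register. Bob's last operation does
  not act on that register, whose diagonal on the branch \<open>a\<close> is therefore
  \<open>\<onehalf> (\<alpha>\<^sub>a \<otimes> I)\<^sup>T p\<^sub>n\<close> (\<open>accept_prob_le_objective\<close>).

  Lower bound. Given \<open>p\<close> in the polytope, Bob keeps a coherent record of the history \<open>(x,y)\<close> and
  chooses each reply in superposition, with the square roots of the conditional weights
  \<open>p\<^sub>j / p\<^bsub>j-1\<^esub>\<close> as amplitudes. The products of the amplitudes telescope, so that the joint state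
  after round \<open>n\<close> is a superposition with amplitudes \<open>\<surd>(\<onehalf> \<alpha>\<^sub>a(x) p\<^sub>n(x,y))\<close>. Once Bob
  has received \<open>a\<close> and \<open>A'\<close>, the registers that store \<open>x\<close> are for given \<open>a\<close> and \<open>y\<close> in a pure state
  known to him; he resets them, which leaves Alice with \<open>b = a \<oplus> c\<close> and the vector
  \<open>\<Sum>\<^sub>y \<surd>r\<^sub>a(y) e\<^sub>y \<otimes> e\<^sub>y\<close>, where \<open>r\<^sub>a = (\<alpha>\<^sub>a \<otimes> I)\<^sup>T p\<^sub>n\<close>. Its squared overlap with \<open>\<phi>\<^sub>b\<close> is
  the fidelity (\<open>optimal_strategy\<close>).

  The maximum exists because the objective is continuous and the polytope is compact in the
  coordinates that matter (\<open>objective_attains_max\<close>); the problem is convex because the fidelity is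
  concave in its first argument (\<open>fidelity_concave\<close>).
\<close>

(* Intervals {1..n} of rounds and sums of bits are kept in the form in which they are stated. *)
declare One_nat_def [simp del] add_bit_eq_xor [simp del]

lemma UNIV_bit: "(UNIV :: bit set) = {0, 1}"
  by (auto simp: bit_not_zero_iff)

lemma finite_UNIV_bit [simp]: "finite (UNIV :: bit set)"
  by (simp add: UNIV_bit)

lemma bit_add_cancel: "b = a + c \<longleftrightarrow> a = b + c" for a b c :: bit
  by (cases a; cases b; cases c) (auto simp: add_bit_eq_xor)

section \<open>Positive semidefinite matrices\<close>

lemma psd_on_mats: "psd_on S X \<Longrightarrow> X \<in> mats S"
  by (simp add: psd_on_def)

lemma psd_on_form: "psd_on S X \<Longrightarrow> (\<Sum>i\<in>S. \<Sum>j\<in>S. cnj (v i) * X i j * v j) \<in> \<real>\<^sub>\<ge>\<^sub>0"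
  by (simp add: psd_on_def)

lemma sum_nonneg_Reals:
  "(\<And>k. k \<in> I \<Longrightarrow> f k \<in> \<real>\<^sub>\<ge>\<^sub>0) \<Longrightarrow> (\<Sum>k\<in>I. f k) \<in> (\<real>\<^sub>\<ge>\<^sub>0 :: complex set)"
  by (induction I rule: infinite_finite_induct) auto

lemma psd_on_sum:
  assumes "\<And>k. k \<in> I \<Longrightarrow> psd_on S (X k)"
  shows "psd_on S (\<lambda>i j. \<Sum>k\<in>I. X k i j)"
proof -
  have "(\<Sum>i\<in>S. \<Sum>j\<in>S. cnj (v i) * (\<Sum>k\<in>I. X k i j) * v j) \<in> \<real>\<^sub>\<ge>\<^sub>0" for v
  proof -
    have "(\<Sum>i\<in>S. \<Sum>j\<in>S. cnj (v i) * (\<Sum>k\<in>I. X k i j) * v j)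
        = (\<Sum>i\<in>S. \<Sum>j\<in>S. \<Sum>k\<in>I. cnj (v i) * X k i j * v j)"
      by (simp add: sum_distrib_left sum_distrib_right)
    also have "\<dots> = (\<Sum>i\<in>S. \<Sum>k\<in>I. \<Sum>j\<in>S. cnj (v i) * X k i j * v j)"
      by (intro sum.cong refl sum.swap)
    also have "\<dots> = (\<Sum>k\<in>I. \<Sum>i\<in>S. \<Sum>j\<in>S. cnj (v i) * X k i j * v j)"
      by (rule sum.swap)
    also have "\<dots> \<in> \<real>\<^sub>\<ge>\<^sub>0"
      by (intro sum_nonneg_Reals psd_on_form assms)
    finally show ?thesis .
  qed
  moreover have "(\<lambda>i j. \<Sum>k\<in>I. X k i j) \<in> mats S"
    using assms by (auto simp: mats_def psd_on_def intro!: sum.neutral)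
  ultimately show ?thesis by (simp add: psd_on_def)
qed

lemma cnj_sum_times_sum:
  "cnj (\<Sum>i\<in>I. a i) * x * (\<Sum>j\<in>J. b j) = (\<Sum>i\<in>I. \<Sum>j\<in>J. cnj (a i) * x * b j)"
  unfolding cnj_sum sum_distrib_left sum_distrib_right by (rule sum.swap)

text \<open>At a vector \<open>v\<close>, the form of the relabelled matrix is the form of \<open>X\<close> at the
  sums of \<open>v\<close> over the fibres of \<open>f\<close>.\<close>

lemma psd_on_relabel:
  assumes "psd_on T X" "finite S" "finite T" "f ` S \<subseteq> T"
  shows "psd_on S (relabel S f X)"
proof -
  have "(\<Sum>i\<in>S. \<Sum>j\<in>S. cnj (v i) * relabel S f X i j * v j) \<in> \<real>\<^sub>\<ge>\<^sub>0" for v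
  proof -
    let ?F = "\<lambda>k. {i\<in>S. f i = k}"
    have "(\<Sum>i\<in>S. \<Sum>j\<in>S. cnj (v i) * relabel S f X i j * v j)
        = (\<Sum>i\<in>S. \<Sum>j\<in>S. cnj (v i) * X (f i) (f j) * v j)"
      by (intro sum.cong refl) (simp add: relabel_def)
    also have "\<dots> = (\<Sum>i\<in>S. \<Sum>l\<in>T. \<Sum>j\<in>?F l. cnj (v i) * X (f i) (f j) * v j)"
      using assms by (intro sum.cong refl sum.group[symmetric])
    also have "\<dots> = (\<Sum>k\<in>T. \<Sum>i\<in>?F k. \<Sum>l\<in>T. \<Sum>j\<in>?F l. cnj (v i) * X (f i) (f j) * v j)"
      using assms by (intro sum.group[symmetric])
    also have "\<dots> = (\<Sum>k\<in>T. \<Sum>l\<in>T. \<Sum>i\<in>?F k. \<Sum>j\<in>?F l. cnj (v i) * X (f i) (f j) * v j)"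
      by (intro sum.cong refl sum.swap)
    also have "\<dots> = (\<Sum>k\<in>T. \<Sum>l\<in>T. \<Sum>i\<in>?F k. \<Sum>j\<in>?F l. cnj (v i) * X k l * v j)"
      by (intro sum.cong refl) auto
    also have "\<dots> = (\<Sum>k\<in>T. \<Sum>l\<in>T. cnj (\<Sum>i\<in>?F k. v i) * X k l * (\<Sum>j\<in>?F l. v j))"
      by (simp only: cnj_sum_times_sum)
    also have "\<dots> \<in> \<real>\<^sub>\<ge>\<^sub>0"
      by (rule psd_on_form[OF assms(1)])
    finally show ?thesis .
  qed
  then show ?thesis by (simp add: psd_on_def mats_def relabel_def)
qed

text \<open>The form at \<open>v\<close> is the form of \<open>X\<close> at the contraction of \<open>v\<close> with \<open>\<psi>\<close>.\<close>

lemma psd_on_tensor_outer: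
  assumes "psd_on T X" "\<And>e. e \<notin> E \<Longrightarrow> \<psi> e = 0"
  shows "psd_on (E \<times> T) (tensor (outer \<psi>) X)"
proof -
  have "(\<Sum>i\<in>E \<times> T. \<Sum>j\<in>E \<times> T. cnj (v i) * tensor (outer \<psi>) X i j * v j) \<in> \<real>\<^sub>\<ge>\<^sub>0" for v
  proof -
    let ?u = "\<lambda>t. \<Sum>e\<in>E. cnj (\<psi> e) * v (e, t)"
    have "(\<Sum>i\<in>E \<times> T. \<Sum>j\<in>E \<times> T. cnj (v i) * tensor (outer \<psi>) X i j * v j)
      = (\<Sum>e\<in>E. \<Sum>t\<in>T. \<Sum>e'\<in>E. \<Sum>t'\<in>T.
           cnj (v (e, t)) * (\<psi> e * cnj (\<psi> e') * X t t') * v (e', t'))"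
      unfolding sum.cartesian_product' by (simp add: tensor_def outer_def)
    also have "\<dots> = (\<Sum>t\<in>T. \<Sum>e\<in>E. \<Sum>e'\<in>E. \<Sum>t'\<in>T.
           cnj (v (e, t)) * (\<psi> e * cnj (\<psi> e') * X t t') * v (e', t'))"
      by (rule sum.swap)
    also have "\<dots> = (\<Sum>t\<in>T. \<Sum>e\<in>E. \<Sum>t'\<in>T. \<Sum>e'\<in>E.
           cnj (v (e, t)) * (\<psi> e * cnj (\<psi> e') * X t t') * v (e', t'))"
      by (intro sum.cong refl sum.swap)
    also have "\<dots> = (\<Sum>t\<in>T. \<Sum>t'\<in>T. \<Sum>e\<in>E. \<Sum>e'\<in>E.
           cnj (v (e, t)) * (\<psi> e * cnj (\<psi> e') * X t t') * v (e', t'))"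
      by (intro sum.cong refl sum.swap)
    also have "\<dots> = (\<Sum>t\<in>T. \<Sum>t'\<in>T. cnj (?u t) * X t t' * ?u t')"
      unfolding cnj_sum_times_sum by (intro sum.cong refl) (simp add: mult_ac)
    also have "\<dots> \<in> \<real>\<^sub>\<ge>\<^sub>0" by (rule psd_on_form[OF assms(1)])
    finally show ?thesis .
  qed
  moreover have "tensor (outer \<psi>) X \<in> mats (E \<times> T)"
    using assms by (auto simp: mats_def tensor_def outer_def psd_on_def)
  ultimately show ?thesis by (simp add: psd_on_def)
qed

lemma psd_on_tensor_outer_right:
  assumes "psd_on T X" "\<And>e. e \<notin> E \<Longrightarrow> \<psi> e = 0" "finite E" "finite T"
  shows "psd_on (T \<times> E) (tensor X (outer \<psi>))"
proof -
  have "psd_on (T \<times> E) (relabel (T \<times> E) prod.swap (tensor (outer \<psi>) X))"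
    by (rule psd_on_relabel[OF psd_on_tensor_outer[OF assms(1,2)]]) (use assms in auto)
  also have "relabel (T \<times> E) prod.swap (tensor (outer \<psi>) X) = tensor X (outer \<psi>)"
    using psd_on_mats[OF assms(1)] assms(2)
    by (auto simp: fun_eq_iff relabel_def tensor_def outer_def mats_def)
  finally show ?thesis .
qed

lemma psd_on_id_mat: "finite S \<Longrightarrow> psd_on S (id_mat S)"
proof -
  assume S: "finite S"
  have "(\<Sum>i\<in>S. \<Sum>j\<in>S. cnj (v i) * id_mat S i j * v j) \<in> \<real>\<^sub>\<ge>\<^sub>0" for v
  proof -
    have "(\<Sum>i\<in>S. \<Sum>j\<in>S. cnj (v i) * id_mat S i j * v j) = (\<Sum>i\<in>S. \<Sum>j\<in>S. if i = j then cnj (v i) * v i else 0)"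
      by (intro sum.cong refl) (auto simp: id_mat_def)
    also have "\<dots> = (\<Sum>i\<in>S. cnj (v i) * v i)" using S by simp
    also have "\<dots> \<in> \<real>\<^sub>\<ge>\<^sub>0"
      by (intro sum_nonneg_Reals) (simp add: complex_nonneg_Reals_iff)
    finally show ?thesis .
  qed
  then show ?thesis by (auto simp: psd_on_def mats_def id_mat_def)
qed

lemma psd_on_diag:
  assumes "psd_on S X" "finite S"
  shows "X i i \<in> \<real>\<^sub>\<ge>\<^sub>0"
proof (cases "i \<in> S")
  case True
  have "(\<Sum>k\<in>S. \<Sum>l\<in>S. cnj (of_bool (k = i)) * X k l * of_bool (l = i))
      = (\<Sum>k\<in>S. if k = i then (\<Sum>l\<in>S. if l = i then X k l else 0) else 0)"
    by (intro sum.cong refl) (simp add: of_bool_def if_distrib[of "\<lambda>z. _ * z"] cong: if_cong)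
  also have "\<dots> = X i i" using True assms(2) by simp
  finally have "(\<Sum>k\<in>S. \<Sum>l\<in>S. cnj (of_bool (k = i)) * X k l * of_bool (l = i)) = X i i" .
  then show ?thesis using psd_on_form[OF assms(1), of "\<lambda>k. of_bool (k = i)"] by simp
next
  case False
  then show ?thesis using assms by (simp add: psd_on_def mats_def)
qed

lemma psd_on_trace: "psd_on S X \<Longrightarrow> finite S \<Longrightarrow> trace_on S X \<in> \<real>\<^sub>\<ge>\<^sub>0"
  unfolding trace_on_def by (intro sum_nonneg_Reals psd_on_diag)

text \<open>The Cauchy--Schwarz inequality for the semi-inner product given by a positive
  semidefinite matrix, applied to two basis vectors.\<close>

lemma psd_on_offdiag:
  assumes "psd_on S X" "finite S" "i \<in> S" "j \<in> S"
  shows "Re (X i j) + Re (X j i) \<le> 2 * (sqrt (Re (X i i)) * sqrt (Re (X j j)))"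
proof (cases "i = j")
  case True
  then show ?thesis using psd_on_diag[OF assms(1,2), of i]
    by (simp add: complex_nonneg_Reals_iff)
next
  case False
  define p q r where "p = Re (X i i)" "q = Re (X j j)" "r = Re (X i j) + Re (X j i)"
  have pq: "p \<ge> 0" "q \<ge> 0"
    using psd_on_diag[OF assms(1,2)] by (auto simp: p_q_r_def complex_nonneg_Reals_iff)
  have key: "s * t * r \<le> s\<^sup>2 * p + t\<^sup>2 * q" for s t :: real
  proof -
    define v where "v = (\<lambda>k. if k = i then complex_of_real s else if k = j then - complex_of_real t else 0)"
    have S: "S = insert i (insert j (S - {i, j}))" using assms by auto
    have vz: "v k = 0" if "k \<in> S - {i, j}" for k using that by (auto simp: v_def)
    have 1: "(\<Sum>k\<in>S. f k * v k) = f i * s - f j * t" for f :: "_ \<Rightarrow> complex"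
      by (subst S) (use False assms(2) vz in \<open>simp add: sum.neutral v_def\<close>)
    have 2: "(\<Sum>k\<in>S. cnj (v k) * f k) = s * f i - t * f j" for f :: "_ \<Rightarrow> complex"
      by (subst S) (use False assms(2) vz in \<open>simp add: sum.neutral v_def\<close>)
    have "(\<Sum>k\<in>S. \<Sum>l\<in>S. cnj (v k) * X k l * v l)
        = s * (X i i * s - X i j * t) - t * (X j i * s - X j j * t)"
      unfolding 1 using 2[of "\<lambda>k. X k i * s - X k j * t"] by (simp add: algebra_simps)
    then have "0 \<le> Re (s * (X i i * s - X i j * t) - t * (X j i * s - X j j * t))"
      using psd_on_form[OF assms(1), of v] by (simp add: complex_nonneg_Reals_iff)
    also have "\<dots> = s\<^sup>2 * p + t\<^sup>2 * q - s * t * r"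
      by (simp add: p_q_r_def algebra_simps power2_eq_square)
    finally show ?thesis by simp
  qed
  have "r \<le> 2 * (sqrt p * sqrt q)"
  \<comment> \<open>If a diagonal entry vanishes, its coefficient in \<open>key\<close> may be arbitrarily large.\<close>
  proof (cases "p = 0 \<or> q = 0")
    case True
    have "r \<le> 0"
    proof (rule ccontr)
      assume "\<not> r \<le> 0"
      then have r: "r > 0" by simp
      show False
      proof (cases "p = 0")
        case True
        have "(q + 1) / r * 1 * r \<le> q" using key[of "(q + 1) / r" 1] True by simp
        then show False using r by simp
      next
        case False
        then have "q = 0" using \<open>p = 0 \<or> q = 0\<close> by simp
        then have "1 * ((p + 1) / r) * r \<le> p" using key[of 1 "(p + 1) / r"] by simp
        then show False using r by simp
      qed
    qed
    also have "0 \<le> 2 * (sqrt p * sqrt q)" using pq by simp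
    finally show ?thesis .
  next
    case False
    then have "sqrt p * sqrt q > 0" using pq by simp
    moreover have "sqrt p * sqrt q * r \<le> sqrt p * sqrt q * (2 * (sqrt p * sqrt q))"
    proof -
      have "sqrt q * sqrt p * r \<le> q * p + p * q" using key[of "sqrt q" "sqrt p"] pq by simp
      also have "\<dots> = 2 * ((sqrt p * sqrt p) * (sqrt q * sqrt q))" using pq by simp
      finally show ?thesis by (simp only: mult_ac)
    qed
    ultimately show ?thesis by (simp add: mult_le_cancel_left)
  qed
  then show ?thesis by (simp add: p_q_r_def)
qed

text \<open>Alice's test for \<open>\<phi>\<^sub>b\<close> is the left-hand side with \<open>g = \<surd>\<beta>\<^sub>b\<close>; the right-hand
  side is then a fidelity.\<close>

lemma psd_on_form_le:
  assumes "psd_on S X" "finite S" "\<And>i. i \<in> S \<Longrightarrow> 0 \<le> g i"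
  shows "(\<Sum>i\<in>S. \<Sum>j\<in>S. g i * g j * Re (X i j)) \<le> (\<Sum>i\<in>S. sqrt (Re (X i i)) * g i)\<^sup>2"
proof -
  have "(\<Sum>i\<in>S. \<Sum>j\<in>S. g i * g j * Re (X i j)) = (\<Sum>i\<in>S. \<Sum>j\<in>S. g i * g j * Re (X j i))"
    by (subst sum.swap) (simp add: mult_ac)
  then have "2 * (\<Sum>i\<in>S. \<Sum>j\<in>S. g i * g j * Re (X i j))
      = (\<Sum>i\<in>S. \<Sum>j\<in>S. g i * g j * (Re (X i j) + Re (X j i)))"
    by (simp add: sum.distrib distrib_left)
  also have "\<dots> \<le> (\<Sum>i\<in>S. \<Sum>j\<in>S. g i * g j * (2 * (sqrt (Re (X i i)) * sqrt (Re (X j j)))))"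
    by (intro sum_mono mult_left_mono psd_on_offdiag[OF assms(1,2)] assms mult_nonneg_nonneg)
  also have "\<dots> = 2 * (\<Sum>i\<in>S. sqrt (Re (X i i)) * g i)\<^sup>2"
    by (simp add: power2_eq_square sum_product sum_distrib_left mult_ac)
  finally show ?thesis by simp
qed

section \<open>Quantum operations\<close>

lemma quantum_op_mats: "quantum_op S T \<Phi> \<Longrightarrow> X \<in> mats S \<Longrightarrow> \<Phi> X \<in> mats T"
  by (simp add: quantum_op_def linear_on_mats_def)

lemma quantum_op_trace: "quantum_op S T \<Phi> \<Longrightarrow> X \<in> mats S \<Longrightarrow> trace_on T (\<Phi> X) = trace_on S X"
  by (simp add: quantum_op_def)

lemma quantum_op_linear:
  assumes "quantum_op S T \<Phi>" "X \<in> mats S" "Y \<in> mats S"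
  shows "\<Phi> (\<lambda>i j. z * X i j + Y i j) = (\<lambda>i j. z * \<Phi> X i j + \<Phi> Y i j)"
  using assms unfolding quantum_op_def linear_on_mats_def by blast

lemma quantum_op_zero:
  assumes "quantum_op S T \<Phi>"
  shows "\<Phi> (\<lambda>i j. 0) = (\<lambda>i j. 0)"
proof -
  have "(\<lambda>i j. 0) \<in> mats S" by (simp add: mats_def)
  from quantum_op_linear[OF assms this this, of 1] show ?thesis by (simp add: fun_eq_iff)
qed

lemma quantum_op_scale:
  assumes "quantum_op S T \<Phi>" "X \<in> mats S"
  shows "\<Phi> (\<lambda>i j. z * X i j) = (\<lambda>i j. z * \<Phi> X i j)"
proof -
  have "(\<lambda>i j. 0) \<in> mats S" by (simp add: mats_def)
  from quantum_op_linear[OF assms this, of z] show ?thesis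
    by (simp add: quantum_op_zero[OF assms(1)])
qed

text \<open>Complete positivity speaks of the reference systems \<open>{..<k}\<close>; a bijection carries
  it over to every finite reference system.\<close>

lemma psd_on_ampliate:
  assumes \<Phi>: "quantum_op S T \<Phi>" and X: "psd_on (E \<times> S) X"
    and fin: "finite E" "finite S" "finite T"
  shows "psd_on (E \<times> T) (ampliate \<Phi> X)"
proof -
  obtain h where h: "bij_betw h {..<card E} E"
    using ex_bij_betw_nat_finite[OF fin(1)] by (auto simp: atLeast0LessThan)
  define g where "g = inv_into {..<card E} h"
  have g: "g ` E \<subseteq> {..<card E}" "\<And>e. e \<in> E \<Longrightarrow> h (g e) = e"
    using h bij_betw_inv_into[OF h] by (auto simp: g_def bij_betw_def f_inv_into_f)
  define Y where "Y = relabel ({..<card E} \<times> S) (map_prod h id) X"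
  have "psd_on ({..<card E} \<times> S) Y"
    unfolding Y_def by (rule psd_on_relabel[OF X]) (use fin h in \<open>auto simp: bij_betw_def\<close>)
  then have "psd_on ({..<card E} \<times> T) (ampliate \<Phi> Y)"
    using \<Phi> by (auto simp: quantum_op_def completely_positive_def)
  then have "psd_on (E \<times> T) (relabel (E \<times> T) (map_prod g id) (ampliate \<Phi> Y))"
    by (rule psd_on_relabel) (use fin g in auto)
  also have "relabel (E \<times> T) (map_prod g id) (ampliate \<Phi> Y) = ampliate \<Phi> X"
  proof (intro ext, clarify)
    fix e t e' t'
    have XM: "X \<in> mats (E \<times> S)" using X by (rule psd_on_mats)
    show "relabel (E \<times> T) (map_prod g id) (ampliate \<Phi> Y) (e, t) (e', t') = ampliate \<Phi> X (e, t) (e', t')"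
    proof (cases "e \<in> E \<and> e' \<in> E")
      case True
      have eq: "(\<lambda>s s'. Y (g e, s) (g e', s')) = (\<lambda>s s'. X (e, s) (e', s'))"
        using True g XM by (auto simp: Y_def relabel_def fun_eq_iff mats_def)
      have "(\<lambda>s s'. X (e, s) (e', s')) \<in> mats S" using XM by (auto simp: mats_def)
      then have "\<Phi> (\<lambda>s s'. X (e, s) (e', s')) \<in> mats T" by (rule quantum_op_mats[OF \<Phi>])
      then show ?thesis using True by (auto simp: ampliate_def relabel_def eq mats_def)
    next
      case False
      then have "(\<lambda>s s'. X (e, s) (e', s')) = (\<lambda>s s'. 0)"
        using XM by (auto simp: fun_eq_iff mats_def)
      then show ?thesis using False quantum_op_zero[OF \<Phi>] by (auto simp: ampliate_def relabel_def)
    qed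
  qed
  finally show ?thesis .
qed

text \<open>Positivity is complete positivity with a one-dimensional reference system.\<close>

lemma quantum_op_psd:
  assumes \<Phi>: "quantum_op S T \<Phi>" and X: "psd_on S X" and fin: "finite S" "finite T"
  shows "psd_on T (\<Phi> X)"
proof -
  let ?Y = "tensor (outer (\<lambda>_::unit. 1)) X"
  have "psd_on (UNIV \<times> S) ?Y" by (rule psd_on_tensor_outer[OF X]) simp
  then have "psd_on (UNIV \<times> T) (ampliate \<Phi> ?Y)"
    by (rule psd_on_ampliate[OF \<Phi>]) (use fin in auto)
  then have "psd_on T (relabel T (Pair ()) (ampliate \<Phi> ?Y))"
    by (rule psd_on_relabel) (use fin in auto)
  also have "relabel T (Pair ()) (ampliate \<Phi> ?Y) = \<Phi> X"
    using quantum_op_mats[OF \<Phi> psd_on_mats[OF X]]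
    by (auto simp: relabel_def ampliate_def tensor_def outer_def mats_def fun_eq_iff)
  finally show ?thesis .
qed

definition kraus :: "'k set \<Rightarrow> 's set \<Rightarrow> 't set \<Rightarrow> ('k \<Rightarrow> 't \<Rightarrow> 's \<Rightarrow> complex) \<Rightarrow> 's cmat \<Rightarrow> 't cmat" where
  "kraus I S T K X = (\<lambda>t t'. if t \<in> T \<and> t' \<in> T
     then \<Sum>k\<in>I. \<Sum>s\<in>S. \<Sum>s'\<in>S. K k t s * X s s' * cnj (K k t' s') else 0)"

text \<open>The form of \<open>K Y K\<^sup>*\<close> at \<open>a, b\<close> is the form of \<open>Y\<close> at \<open>K\<^sup>*a, K\<^sup>*b\<close>.\<close>

lemma conjugation_form:
  fixes K :: "'t \<Rightarrow> 's \<Rightarrow> complex"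
  shows "(\<Sum>t\<in>T. \<Sum>t'\<in>T. cnj (a t) * (\<Sum>s\<in>S. \<Sum>s'\<in>S. K t s * Y s s' * cnj (K t' s')) * b t')
    = (\<Sum>s\<in>S. \<Sum>s'\<in>S. cnj (\<Sum>t\<in>T. cnj (K t s) * a t) * Y s s' * (\<Sum>t'\<in>T. cnj (K t' s') * b t'))"
proof -
  have "(\<Sum>t\<in>T. \<Sum>t'\<in>T. cnj (a t) * (\<Sum>s\<in>S. \<Sum>s'\<in>S. K t s * Y s s' * cnj (K t' s')) * b t')
    = (\<Sum>t\<in>T. \<Sum>t'\<in>T. \<Sum>s\<in>S. \<Sum>s'\<in>S. cnj (cnj (K t s) * a t) * Y s s' * (cnj (K t' s') * b t'))"
    by (intro sum.cong refl) (simp add: sum_distrib_left sum_distrib_right mult_ac)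
  also have "\<dots> = (\<Sum>t\<in>T. \<Sum>s\<in>S. \<Sum>t'\<in>T. \<Sum>s'\<in>S. cnj (cnj (K t s) * a t) * Y s s' * (cnj (K t' s') * b t'))"
    by (intro sum.cong refl sum.swap)
  also have "\<dots> = (\<Sum>s\<in>S. \<Sum>t\<in>T. \<Sum>t'\<in>T. \<Sum>s'\<in>S. cnj (cnj (K t s) * a t) * Y s s' * (cnj (K t' s') * b t'))"
    by (rule sum.swap)
  also have "\<dots> = (\<Sum>s\<in>S. \<Sum>t\<in>T. \<Sum>s'\<in>S. \<Sum>t'\<in>T. cnj (cnj (K t s) * a t) * Y s s' * (cnj (K t' s') * b t'))"
    by (intro sum.cong refl sum.swap)
  also have "\<dots> = (\<Sum>s\<in>S. \<Sum>s'\<in>S. \<Sum>t\<in>T. \<Sum>t'\<in>T. cnj (cnj (K t s) * a t) * Y s s' * (cnj (K t' s') * b t'))"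
    by (intro sum.cong refl sum.swap)
  finally show ?thesis unfolding cnj_sum_times_sum .
qed

lemma psd_on_kraus_single:
  fixes K :: "'t \<Rightarrow> 's \<Rightarrow> complex"
  assumes X: "psd_on (E \<times> S) X"
  shows "psd_on (E \<times> T) (\<lambda>(e, t) (e', t'). if t \<in> T \<and> t' \<in> T
     then \<Sum>s\<in>S. \<Sum>s'\<in>S. K t s * X (e, s) (e', s') * cnj (K t' s') else 0)" (is "psd_on _ ?Z")
proof -
  have "(\<Sum>i\<in>E \<times> T. \<Sum>j\<in>E \<times> T. cnj (v i) * ?Z i j * v j) \<in> \<real>\<^sub>\<ge>\<^sub>0" for v
  proof -
    let ?u = "\<lambda>(e, s). \<Sum>t\<in>T. cnj (K t s) * v (e, t)"
    have "(\<Sum>i\<in>E \<times> T. \<Sum>j\<in>E \<times> T. cnj (v i) * ?Z i j * v j)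
      = (\<Sum>e\<in>E. \<Sum>t\<in>T. \<Sum>e'\<in>E. \<Sum>t'\<in>T. cnj (v (e, t)) *
          (\<Sum>s\<in>S. \<Sum>s'\<in>S. K t s * X (e, s) (e', s') * cnj (K t' s')) * v (e', t'))"
      unfolding sum.cartesian_product' by (intro sum.cong refl) simp
    also have "\<dots> = (\<Sum>e\<in>E. \<Sum>e'\<in>E. \<Sum>t\<in>T. \<Sum>t'\<in>T. cnj (v (e, t)) *
          (\<Sum>s\<in>S. \<Sum>s'\<in>S. K t s * X (e, s) (e', s') * cnj (K t' s')) * v (e', t'))"
      by (intro sum.cong refl sum.swap)
    also have "\<dots> = (\<Sum>e\<in>E. \<Sum>e'\<in>E. \<Sum>s\<in>S. \<Sum>s'\<in>S. cnj (?u (e, s)) * X (e, s) (e', s') * ?u (e', s'))"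
      unfolding conjugation_form prod.case ..
    also have "\<dots> = (\<Sum>e\<in>E. \<Sum>s\<in>S. \<Sum>e'\<in>E. \<Sum>s'\<in>S. cnj (?u (e, s)) * X (e, s) (e', s') * ?u (e', s'))"
      by (intro sum.cong refl sum.swap)
    also have "\<dots> = (\<Sum>i\<in>E \<times> S. \<Sum>j\<in>E \<times> S. cnj (?u i) * X i j * ?u j)"
      unfolding sum.cartesian_product' ..
    also have "\<dots> \<in> \<real>\<^sub>\<ge>\<^sub>0" by (rule psd_on_form[OF X])
    finally show ?thesis .
  qed
  moreover have "?Z \<in> mats (E \<times> T)"
    using psd_on_mats[OF X] by (auto simp: mats_def intro!: sum.neutral)
  ultimately show ?thesis by (simp add: psd_on_def)
qed

lemma quantum_op_kraus:
  fixes K :: "'k \<Rightarrow> 't \<Rightarrow> 's \<Rightarrow> complex"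
  assumes "finite S"
    and iso: "\<And>s s'. s \<in> S \<Longrightarrow> s' \<in> S \<Longrightarrow>
      (\<Sum>k\<in>I. \<Sum>t\<in>T. cnj (K k t s') * K k t s) = (if s = s' then 1 else 0)"
  shows "quantum_op S T (kraus I S T K)"
  unfolding quantum_op_def
proof (intro conjI ballI)
  show "linear_on_mats S T (kraus I S T K)"
    unfolding linear_on_mats_def
    by (auto simp: kraus_def mats_def fun_eq_iff algebra_simps sum.distrib sum_distrib_left)
  show "completely_positive S T (kraus I S T K)"
    unfolding completely_positive_def
  proof (intro allI impI)
    fix k :: nat and X :: "(nat \<times> 's) cmat"
    assume X: "psd_on ({..<k} \<times> S) X"
    have "psd_on ({..<k} \<times> T) (\<lambda>i j. \<Sum>l\<in>I. (\<lambda>(e, t) (e', t'). if t \<in> T \<and> t' \<in> T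
       then \<Sum>s\<in>S. \<Sum>s'\<in>S. K l t s * X (e, s) (e', s') * cnj (K l t' s') else 0) i j)"
      by (intro psd_on_sum psd_on_kraus_single X)
    also have "(\<lambda>i j. \<Sum>l\<in>I. (\<lambda>(e, t) (e', t'). if t \<in> T \<and> t' \<in> T
       then \<Sum>s\<in>S. \<Sum>s'\<in>S. K l t s * X (e, s) (e', s') * cnj (K l t' s') else 0) i j)
       = ampliate (kraus I S T K) X"
      by (auto simp: fun_eq_iff ampliate_def kraus_def)
    finally show "psd_on ({..<k} \<times> T) (ampliate (kraus I S T K) X)" .
  qed
  fix X :: "'s cmat" assume "X \<in> mats S"
  have "trace_on T (kraus I S T K X)
    = (\<Sum>t\<in>T. \<Sum>k\<in>I. \<Sum>s\<in>S. \<Sum>s'\<in>S. X s s' * (cnj (K k t s') * K k t s))"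
    by (simp add: trace_on_def kraus_def mult_ac)
  also have "\<dots> = (\<Sum>k\<in>I. \<Sum>t\<in>T. \<Sum>s\<in>S. \<Sum>s'\<in>S. X s s' * (cnj (K k t s') * K k t s))"
    by (rule sum.swap)
  also have "\<dots> = (\<Sum>k\<in>I. \<Sum>s\<in>S. \<Sum>t\<in>T. \<Sum>s'\<in>S. X s s' * (cnj (K k t s') * K k t s))"
    by (intro sum.cong refl sum.swap)
  also have "\<dots> = (\<Sum>s\<in>S. \<Sum>k\<in>I. \<Sum>t\<in>T. \<Sum>s'\<in>S. X s s' * (cnj (K k t s') * K k t s))"
    by (rule sum.swap)
  also have "\<dots> = (\<Sum>s\<in>S. \<Sum>k\<in>I. \<Sum>s'\<in>S. \<Sum>t\<in>T. X s s' * (cnj (K k t s') * K k t s))"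
    by (intro sum.cong refl sum.swap)
  also have "\<dots> = (\<Sum>s\<in>S. \<Sum>s'\<in>S. \<Sum>k\<in>I. \<Sum>t\<in>T. X s s' * (cnj (K k t s') * K k t s))"
    by (intro sum.cong refl sum.swap)
  also have "\<dots> = (\<Sum>s\<in>S. \<Sum>s'\<in>S. X s s' * (\<Sum>k\<in>I. \<Sum>t\<in>T. cnj (K k t s') * K k t s))"
    by (simp add: sum_distrib_left)
  also have "\<dots> = (\<Sum>s\<in>S. \<Sum>s'\<in>S. if s = s' then X s s' else 0)"
    by (intro sum.cong refl) (simp add: iso)
  also have "\<dots> = trace_on S X" using assms(1) by (simp add: trace_on_def)
  finally show "trace_on T (kraus I S T K X) = trace_on S X" .
qed

lemma kraus_outer:
  assumes "t \<in> T" "t' \<in> T"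
  shows "kraus I S T K (\<lambda>s s'. \<psi> s * cnj (\<xi> s')) t t'
    = (\<Sum>k\<in>I. (\<Sum>s\<in>S. K k t s * \<psi> s) * cnj (\<Sum>s\<in>S. K k t' s * \<xi> s))"
  using assms by (simp add: kraus_def sum_product mult_ac)

text \<open>Both kinds of operation in Bob's optimal strategy are naturally partial isometries. The
  defect \<open>1 - V\<^sup>*V\<close> of a partial isometry is a projection \<open>Q\<close>, so the map
  \<open>X \<mapsto> V X V\<^sup>* + tr (Q X) e e\<^sup>*\<close>, with \<open>e\<close> any basis vector of the target, is a quantum
  operation, and its second summand vanishes on \<open>\<psi> \<xi>\<^sup>*\<close> if \<open>V\<^sup>*V \<psi> = \<psi>\<close>.\<close>

lemma partial_isometry_quantum_op:
  fixes V :: "'t \<Rightarrow> 's \<Rightarrow> complex"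
  assumes fin: "finite S" "finite T" and t0: "t0 \<in> T"
    and partial: "\<forall>t\<in>T. \<forall>s\<in>S. (\<Sum>r\<in>S. V t r * (\<Sum>t'\<in>T. cnj (V t' r) * V t' s)) = V t s"
  shows "\<exists>\<Phi>. quantum_op S T \<Phi> \<and>
    (\<forall>\<psi> \<xi>. (\<forall>s\<in>S. (\<Sum>t\<in>T. cnj (V t s) * (\<Sum>r\<in>S. V t r * \<psi> r)) = \<psi> s) \<longrightarrow>
      \<Phi> (\<lambda>s s'. \<psi> s * cnj (\<xi> s')) = (\<lambda>t t'. if t \<in> T \<and> t' \<in> T
        then (\<Sum>s\<in>S. V t s * \<psi> s) * cnj (\<Sum>s\<in>S. V t' s * \<xi> s) else 0))"
proof -
  define P where "P r s = (\<Sum>t\<in>T. cnj (V t r) * V t s)" for r s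
  define Q where "Q r s = (if r = s then 1 else 0) - P r s" for r s
  \<comment> \<open>Besides \<open>V\<close>, there is one Kraus operator \<open>e e\<^sub>r\<^sup>* Q\<close> for each basis vector \<open>e\<^sub>r\<close> of the source.\<close>
  define K where "K k t s = (case k of None \<Rightarrow> V t s | Some r \<Rightarrow> if t = t0 then Q r s else 0)" for k t s
  define I where "I = insert None (Some ` S)"
  have sum_I: "(\<Sum>k\<in>I. f k) = f None + (\<Sum>r\<in>S. f (Some r))" for f :: "'s option \<Rightarrow> complex"
    using fin by (simp add: I_def sum.reindex)
  have P_cnj: "cnj (P r s) = P s r" for r s by (simp add: P_def mult_ac)
  have PP: "(\<Sum>r\<in>S. P s' r * P r s) = P s' s" if "s \<in> S" for s s'
  proof -
    have "(\<Sum>r\<in>S. P s' r * P r s) = (\<Sum>r\<in>S. \<Sum>t\<in>T. cnj (V t s') * (V t r * P r s))"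
      by (simp add: P_def[of s'] sum_distrib_left sum_distrib_right mult_ac)
    also have "\<dots> = (\<Sum>t\<in>T. cnj (V t s') * (\<Sum>r\<in>S. V t r * P r s))"
      by (subst sum.swap) (simp add: sum_distrib_left)
    also have "\<dots> = P s' s" using partial that by (simp add: P_def)
    finally show ?thesis .
  qed
  have "quantum_op S T (kraus I S T K)"
  proof (rule quantum_op_kraus[OF fin(1)])
    fix s s' assume s: "s \<in> S" "s' \<in> S"
    have QQ: "cnj (Q r s') * Q r s = (if s = s' then if r = s then 1 else 0 else 0)
        - (if r = s then P s' r else 0) - (if r = s' then P r s else 0) + P s' r * P r s" for r
      by (auto simp: Q_def P_cnj algebra_simps)
    have "(\<Sum>k\<in>I. \<Sum>t\<in>T. cnj (K k t s') * K k t s)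
      = P s' s + (\<Sum>r\<in>S. \<Sum>t\<in>T. if t = t0 then cnj (Q r s') * Q r s else 0)"
      unfolding sum_I by (simp add: K_def P_def if_distrib[of cnj] if_distrib[of "\<lambda>z. _ * z"] cong: if_cong)
    also have "\<dots> = P s' s + (\<Sum>r\<in>S. cnj (Q r s') * Q r s)"
      using fin t0 by simp
    also have "\<dots> = (if s = s' then 1 else 0)"
      unfolding QQ using fin s PP[OF s(1)] by (simp add: sum.distrib sum_subtractf)
    finally show "(\<Sum>k\<in>I. \<Sum>t\<in>T. cnj (K k t s') * K k t s) = (if s = s' then 1 else 0)" .
  qed
  moreover have "kraus I S T K (\<lambda>s s'. \<psi> s * cnj (\<xi> s')) = (\<lambda>t t'. if t \<in> T \<and> t' \<in> T
           then (\<Sum>s\<in>S. V t s * \<psi> s) * cnj (\<Sum>s\<in>S. V t' s * \<xi> s) else 0)"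
    if \<psi>: "\<forall>s\<in>S. (\<Sum>t\<in>T. cnj (V t s) * (\<Sum>r\<in>S. V t r * \<psi> r)) = \<psi> s" for \<psi> \<xi>
  proof -
    have "(\<Sum>s\<in>S. Q r s * \<psi> s) = 0" if "r \<in> S" for r
    proof -
      have "(\<Sum>s\<in>S. Q r s * \<psi> s) = (\<Sum>s\<in>S. (if r = s then \<psi> s else 0) - P r s * \<psi> s)"
        by (intro sum.cong refl) (simp add: Q_def algebra_simps)
      also have "\<dots> = \<psi> r - (\<Sum>s\<in>S. P r s * \<psi> s)"
        using that fin by (simp add: sum_subtractf)
      also have "(\<Sum>s\<in>S. P r s * \<psi> s) = (\<Sum>s\<in>S. \<Sum>t\<in>T. cnj (V t r) * (V t s * \<psi> s))"
        by (simp add: P_def sum_distrib_left sum_distrib_right mult_ac)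
      also have "\<dots> = \<psi> r"
        by (subst sum.swap) (simp add: sum_distrib_left[symmetric] \<psi> that)
      finally show ?thesis by simp
    qed
    then have "(\<Sum>s\<in>S. K (Some r) t s * \<psi> s) = 0" if "r \<in> S" for r t
      using that by (cases "t = t0") (simp_all add: K_def)
    then have "kraus I S T K (\<lambda>s s'. \<psi> s * cnj (\<xi> s')) t t' =
        (\<Sum>s\<in>S. V t s * \<psi> s) * cnj (\<Sum>s\<in>S. V t' s * \<xi> s)" if "t \<in> T" "t' \<in> T" for t t'
      unfolding kraus_outer[OF that] sum_I by (simp add: K_def)
    then show ?thesis by (auto simp: fun_eq_iff kraus_def)
  qed
  ultimately show ?thesis by blast
qed

section \<open>Concavity of the fidelity\<close>

text \<open>With \<open>u, v, u', v'\<close> for the four roots, the squares of the two sides differ by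
  \<open>t (1 - t) (u v' - u' v)\<^sup>2\<close>.\<close>

lemma sqrt_mult_concave:
  fixes a b a' b' t :: real
  assumes "0 \<le> a" "0 \<le> b" "0 \<le> a'" "0 \<le> b'" "0 \<le> t" "t \<le> 1"
  shows "(1 - t) * (sqrt a * sqrt b) + t * (sqrt a' * sqrt b')
    \<le> sqrt ((1 - t) * a + t * a') * sqrt ((1 - t) * b + t * b')"
proof -
  define u v u' v' where "u = sqrt a" "v = sqrt b" "u' = sqrt a'" "v' = sqrt b'"
  have sq: "a = u\<^sup>2" "b = v\<^sup>2" "a' = u'\<^sup>2" "b' = v'\<^sup>2" using assms by (auto simp: u_v_u'_v'_def)
  have "((1 - t) * (u * v) + t * (u' * v'))\<^sup>2 \<le> ((1 - t) * u\<^sup>2 + t * u'\<^sup>2) * ((1 - t) * v\<^sup>2 + t * v'\<^sup>2)"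
  proof -
    have "((1 - t) * u\<^sup>2 + t * u'\<^sup>2) * ((1 - t) * v\<^sup>2 + t * v'\<^sup>2) - ((1 - t) * (u * v) + t * (u' * v'))\<^sup>2
       = t * (1 - t) * (u * v' - u' * v)\<^sup>2" by algebra
    also have "\<dots> \<ge> 0" using assms by simp
    finally show ?thesis by simp
  qed
  then have "(1 - t) * (u * v) + t * (u' * v') \<le> sqrt (((1 - t) * u\<^sup>2 + t * u'\<^sup>2) * ((1 - t) * v\<^sup>2 + t * v'\<^sup>2))"
    by (rule real_le_rsqrt)
  then show ?thesis unfolding sq using assms by (simp add: real_sqrt_mult u_v_u'_v'_def)
qed

text \<open>Expanded as \<open>\<Sum>\<^sub>x\<^sub>y \<surd>(q\<^sub>x q\<^sub>y) \<surd>(p\<^sub>x p\<^sub>y)\<close>, the fidelity is a nonnegative combination of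
  geometric means, each of which is concave.\<close>

lemma fidelity_concave:
  assumes "\<And>x. x \<in> S \<Longrightarrow> 0 \<le> p x" "\<And>x. x \<in> S \<Longrightarrow> 0 \<le> p' x" "\<And>x. x \<in> S \<Longrightarrow> 0 \<le> q x"
    and "0 \<le> t" "t \<le> 1"
  shows "(1 - t) * fidelity S p q + t * fidelity S p' q \<le> fidelity S (\<lambda>x. (1 - t) * p x + t * p' x) q"
proof -
  have F: "fidelity S r q = (\<Sum>x\<in>S. \<Sum>y\<in>S. (sqrt (q x) * sqrt (q y)) * (sqrt (r x) * sqrt (r y)))" for r
    by (simp add: fidelity_def power2_eq_square sum_product mult_ac)
  have "(1 - t) * fidelity S p q + t * fidelity S p' q
    = (\<Sum>x\<in>S. \<Sum>y\<in>S. (sqrt (q x) * sqrt (q y)) *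
        ((1 - t) * (sqrt (p x) * sqrt (p y)) + t * (sqrt (p' x) * sqrt (p' y))))"
    unfolding F sum_distrib_left sum.distrib[symmetric] by (intro sum.cong refl) (simp add: algebra_simps)
  also have "\<dots> \<le> fidelity S (\<lambda>x. (1 - t) * p x + t * p' x) q"
    unfolding F using assms by (intro sum_mono mult_left_mono sqrt_mult_concave) auto
  finally show ?thesis .
qed

lemma fidelity_mono:
  assumes "\<And>x. x \<in> S \<Longrightarrow> 0 \<le> p x" "\<And>x. x \<in> S \<Longrightarrow> p x \<le> p' x" "\<And>x. x \<in> S \<Longrightarrow> 0 \<le> q x"
  shows "fidelity S p q \<le> fidelity S p' q"
  unfolding fidelity_def using assms
  by (intro power_mono sum_mono mult_right_mono sum_nonneg) auto

lemma fidelity_scale: "0 \<le> z \<Longrightarrow> fidelity S (\<lambda>x. z * p x) q = z * fidelity S p q"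
  by (simp add: fidelity_def real_sqrt_mult mult.assoc sum_distrib_left[symmetric] power_mult_distrib)

lemma fidelity_cong: "(\<And>x. x \<in> S \<Longrightarrow> p x = p' x) \<Longrightarrow> fidelity S p q = fidelity S p' q"
  by (simp add: fidelity_def)

section \<open>Products of label sets\<close>

lemma sum_image_support:
  assumes "finite S" "inj_on g X" "g ` X \<subseteq> S" "\<And>s. s \<in> S \<Longrightarrow> s \<notin> g ` X \<Longrightarrow> f s = 0"
  shows "(\<Sum>s\<in>S. f s) = (\<Sum>x\<in>X. f (g x))"
proof -
  have "(\<Sum>s\<in>S. f s) = (\<Sum>s\<in>g ` X. f s)"
    using assms by (intro sum.mono_neutral_right) auto
  then show ?thesis by (simp add: sum.reindex[OF assms(2)])
qed

lemma sum_PiE_Suc: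
  "(\<Sum>y\<in>Pi\<^sub>E {1..Suc j} B. f y) = (\<Sum>y\<in>Pi\<^sub>E {1..j} B. \<Sum>b\<in>B (Suc j). f (y(Suc j := b)))"
proof -
  have 1: "{1..Suc j} = insert (Suc j) {1..j}" by auto
  have inj: "inj_on (\<lambda>(b, y). y(Suc j := b)) (B (Suc j) \<times> Pi\<^sub>E {1..j} B)"
    by (rule inj_combinator) simp
  have "(\<Sum>y\<in>Pi\<^sub>E {1..Suc j} B. f y) = (\<Sum>(b, y)\<in>B (Suc j) \<times> Pi\<^sub>E {1..j} B. f (y(Suc j := b)))"
    unfolding 1 PiE_insert_eq by (subst sum.reindex[OF inj]) (simp add: case_prod_unfold)
  also have "\<dots> = (\<Sum>b\<in>B (Suc j). \<Sum>y\<in>Pi\<^sub>E {1..j} B. f (y(Suc j := b)))"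
    by (simp add: sum.cartesian_product)
  finally show ?thesis by (subst sum.swap)
qed

lemma PiE_fun_upd_Suc:
  "y \<in> Pi\<^sub>E {1..j} B \<Longrightarrow> b \<in> B (Suc j) \<Longrightarrow> y(Suc j := b) \<in> Pi\<^sub>E {1..Suc j} B"
  by (fastforce simp: PiE_def Pi_def extensional_def)

lemma PiE_restrict:
  fixes j k :: nat
  shows "y \<in> Pi\<^sub>E {1..k} B \<Longrightarrow> j \<le> k \<Longrightarrow> restrict y {1..j} \<in> Pi\<^sub>E {1..j} B"
  unfolding restrict_PiE_iff by (intro ballI, drule PiE_mem) auto

lemma restrict_fun_upd_Suc: "y \<in> Pi\<^sub>E {1..j} B \<Longrightarrow> restrict (y(Suc j := b)) {1..j} = y"
  by (fastforce simp: PiE_def extensional_def fun_eq_iff)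

lemma restrict_fun_upd_same: "y \<in> Pi\<^sub>E {1..Suc j} B \<Longrightarrow> (restrict y {1..j})(Suc j := y (Suc j)) = y"
  by (fastforce simp: PiE_def extensional_def fun_eq_iff le_Suc_eq)

section \<open>The polytope\<close>

text \<open>With the convention that the empty history has weight one, all
  equality constraints of the polytope have the same form.\<close>

definition weight :: "('a, 'b) cheat_vec \<Rightarrow> ('a, 'b) cheat_vec" where
  "weight p j x y = (if j = 0 then 1 else p j x y)"

lemma bob_polytope_iff:
  "p \<in> bob_polytope n A B \<longleftrightarrow>
    (\<forall>j\<in>{1..n}. \<forall>x\<in>Pi\<^sub>E {1..j} A. \<forall>y\<in>Pi\<^sub>E {1..j} B. 0 \<le> p j x y) \<and>
    (\<forall>j<n. \<forall>x\<in>Pi\<^sub>E {1..Suc j} A. \<forall>y\<in>Pi\<^sub>E {1..j} B.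
       (\<Sum>b\<in>B (Suc j). p (Suc j) x (y(Suc j := b))) = weight p j (restrict x {1..j}) y)" if "n \<ge> 1"
proof -
  have "(\<forall>j<n. R j) \<longleftrightarrow> R 0 \<and> (\<forall>j\<in>{2..n}. R (j - 1))" for R :: "nat \<Rightarrow> bool"
  proof (intro iffI conjI allI impI ballI)
    fix j assume "R 0 \<and> (\<forall>j\<in>{2..n}. R (j - 1))" "j < n"
    then show "R j" by (cases j) (auto dest: bspec[of _ _ "Suc j"])
  qed (use that in auto)
  note split = this
  have Suc: "Suc (j - 1) = j" if "j \<in> {2..n}" for j using that by auto
  show ?thesis
    unfolding bob_polytope_def mem_Collect_eq split using that
    by (simp add: weight_def Suc One_nat_def cong: ball_cong) (auto simp: PiE_def One_nat_def)
qed

lemma compact_PiE_UNIV: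
  fixes K :: "'i \<Rightarrow> 'c::topological_space set"
  assumes "\<And>i. compact (K i)"
  shows "compact (Pi\<^sub>E UNIV K)"
proof -
  have "compactin (product_topology (\<lambda>i::'i. euclidean) UNIV) (Pi\<^sub>E UNIV K)"
    using assms by (simp add: compactin_PiE)
  then show ?thesis by (simp add: euclidean_product_topology)
qed

locale coin_flipping =
  fixes n :: nat
    and A :: "nat \<Rightarrow> 'a set" and B :: "nat \<Rightarrow> 'b set"
    and \<alpha> :: "bit \<Rightarrow> (nat \<Rightarrow> 'a) \<Rightarrow> real" and \<beta> :: "bit \<Rightarrow> (nat \<Rightarrow> 'b) \<Rightarrow> real"
    and c :: bit
  assumes n: "n \<ge> 1"
    and finA: "\<And>i. i \<in> {1..n} \<Longrightarrow> finite (A i)"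
    and finB: "\<And>i. i \<in> {1..n} \<Longrightarrow> finite (B i)"
    and prob_\<alpha>: "\<And>a. prob_vec (Pi\<^sub>E {1..n} A) (\<alpha> a)"
    and prob_\<beta>: "\<And>b. prob_vec (Pi\<^sub>E {1..n} B) (\<beta> b)"
begin

abbreviation "PA j \<equiv> Pi\<^sub>E {1..j} A"
abbreviation "PB j \<equiv> Pi\<^sub>E {1..j} B"
abbreviation "cheats \<equiv> bob_polytope n A B"
abbreviation "objective \<equiv> bob_objective n A B \<alpha> \<beta> c"

lemma finite_PA: "j \<le> n \<Longrightarrow> finite (PA j)"
  by (auto intro!: finite_PiE finA)

lemma finite_PB: "j \<le> n \<Longrightarrow> finite (PB j)"
  by (auto intro!: finite_PiE finB)

lemma \<alpha>_nonneg: "x \<in> PA n \<Longrightarrow> 0 \<le> \<alpha> a x" and sum_\<alpha>: "(\<Sum>x\<in>PA n. \<alpha> a x) = 1"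
  using prob_\<alpha> by (auto simp: prob_vec_def)

lemma \<beta>_nonneg: "y \<in> PB n \<Longrightarrow> 0 \<le> \<beta> b y" and sum_\<beta>: "(\<Sum>y\<in>PB n. \<beta> b y) = 1"
  using prob_\<beta> by (auto simp: prob_vec_def)

lemma polytope_iff:
  "p \<in> cheats \<longleftrightarrow>
    (\<forall>j\<in>{1..n}. \<forall>x\<in>PA j. \<forall>y\<in>PB j. 0 \<le> p j x y) \<and>
    (\<forall>j<n. \<forall>x\<in>PA (Suc j). \<forall>y\<in>PB j.
       (\<Sum>b\<in>B (Suc j). p (Suc j) x (y(Suc j := b))) = weight p j (restrict x {1..j}) y)"
  by (rule bob_polytope_iff[OF n])

lemma weight_nonneg:
  "p \<in> cheats \<Longrightarrow> j \<le> n \<Longrightarrow> x \<in> PA j \<Longrightarrow> y \<in> PB j \<Longrightarrow> 0 \<le> weight p j x y"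
  by (auto simp: polytope_iff weight_def)

lemma polytope_nonneg: "p \<in> cheats \<Longrightarrow> x \<in> PA n \<Longrightarrow> y \<in> PB n \<Longrightarrow> 0 \<le> p n x y"
  using n by (auto simp: polytope_iff)

lemma sum_weight_Suc:
  assumes "p \<in> cheats" "j < n" "x \<in> PA (Suc j)" "y \<in> PB j"
  shows "(\<Sum>b\<in>B (Suc j). weight p (Suc j) x (y(Suc j := b))) = weight p j (restrict x {1..j}) y"
  using assms by (auto simp: polytope_iff weight_def)

text \<open>The constraints sum out Bob's replies one at a time, starting with the last.\<close>

lemma sum_weight:
  assumes p: "p \<in> cheats"
  shows "j \<le> n \<Longrightarrow> x \<in> PA j \<Longrightarrow> (\<Sum>y\<in>PB j. weight p j x y) = 1"
proof (induction j arbitrary: x)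
  case 0
  then show ?case by (simp add: weight_def)
next
  case (Suc j)
  then have "(\<Sum>y\<in>PB (Suc j). weight p (Suc j) x y) = (\<Sum>y\<in>PB j. weight p j (restrict x {1..j}) y)"
    unfolding sum_PiE_Suc by (intro sum.cong refl sum_weight_Suc p) auto
  also have "\<dots> = 1" using Suc by (intro Suc.IH PiE_restrict[of _ "Suc j"]) auto
  finally show ?case .
qed

lemma weight_le_1:
  assumes "p \<in> cheats" "j \<le> n" "x \<in> PA j" "y \<in> PB j"
  shows "weight p j x y \<le> 1"
proof -
  have "weight p j x y \<le> (\<Sum>y\<in>PB j. weight p j x y)"
    using assms by (intro member_le_sum finite_PB weight_nonneg) auto
  then show ?thesis using sum_weight assms by simp
qed

lemma weight_n: "weight p n = p n"
  using n by (simp add: weight_def fun_eq_iff)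

lemma reduced_vec_nonneg: "p \<in> cheats \<Longrightarrow> y \<in> PB n \<Longrightarrow> 0 \<le> reduced_vec n A (\<alpha> a) p y"
  unfolding reduced_vec_def by (intro sum_nonneg mult_nonneg_nonneg \<alpha>_nonneg polytope_nonneg)

lemma prob_vec_reduced:
  assumes "p \<in> cheats"
  shows "prob_vec (PB n) (reduced_vec n A (\<alpha> a) p)"
proof -
  have "(\<Sum>y\<in>PB n. reduced_vec n A (\<alpha> a) p y) = (\<Sum>x\<in>PA n. \<alpha> a x * (\<Sum>y\<in>PB n. p n x y))"
    unfolding reduced_vec_def by (subst sum.swap) (simp add: sum_distrib_left)
  also have "\<dots> = (\<Sum>x\<in>PA n. \<alpha> a x)"
    using sum_weight[OF assms, of n] by (simp add: weight_n)
  finally show ?thesis using assms by (simp add: prob_vec_def reduced_vec_nonneg sum_\<alpha>)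
qed

lemma convex_maximization_polytope: "convex_maximization cheats objective"
  unfolding convex_maximization_def Let_def
proof (intro ballI conjI)
  fix p q :: "('a, 'b) cheat_vec" and t :: real
  assume p: "p \<in> cheats" and q: "q \<in> cheats" and t: "t \<in> {0..1}"
  let ?r = "\<lambda>j x y. (1 - t) * p j x y + t * q j x y"
  have w: "weight ?r j x y = (1 - t) * weight p j x y + t * weight q j x y" for j x y
    by (simp add: weight_def)
  show "?r \<in> cheats"
    using p q t unfolding polytope_iff w
    by (auto simp: sum.distrib sum_distrib_left[symmetric])
  have r: "reduced_vec n A (\<alpha> a) ?r
      = (\<lambda>y. (1 - t) * reduced_vec n A (\<alpha> a) p y + t * reduced_vec n A (\<alpha> a) q y)" for a
    by (simp add: reduced_vec_def fun_eq_iff sum_distrib_left sum.distrib[symmetric] algebra_simps)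
  have "(1 - t) * objective p + t * objective q = 1 / 2 * (\<Sum>a\<in>{0, 1}.
      (1 - t) * fidelity (PB n) (reduced_vec n A (\<alpha> a) p) (\<beta> (a + c))
      + t * fidelity (PB n) (reduced_vec n A (\<alpha> a) q) (\<beta> (a + c)))"
    by (simp only: bob_objective_def sum.distrib sum_distrib_left[symmetric] distrib_left mult.left_commute)
  also have "\<dots> \<le> objective ?r"
    unfolding bob_objective_def r using t
    by (intro mult_left_mono sum_mono fidelity_concave reduced_vec_nonneg p q \<beta>_nonneg) auto
  finally show "(1 - t) * objective p + t * objective q \<le> objective ?r" .
qed

lemma polytope_nonempty: "cheats \<noteq> {}"
proof -
  have "PB n \<noteq> {}" using sum_\<beta>[of 0] by (intro notI) simp
  then obtain y0 where y0: "y0 \<in> PB n" by blast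
  \<comment> \<open>Bob ignores Alice and sends a fixed sequence of replies.\<close>
  define p :: "('a, 'b) cheat_vec" where "p j x y = of_bool (y = restrict y0 {1..j})" for j x y
  have "p \<in> cheats"
    unfolding polytope_iff
  proof (intro conjI ballI allI impI)
    fix j x y assume j: "j < n" and y: "y \<in> PB j"
    have upd: "y(Suc j := b) = restrict y0 {1..Suc j} \<longleftrightarrow> y = restrict y0 {1..j} \<and> b = y0 (Suc j)" for b
    proof -
      have z: "restrict y0 {1..j} \<in> PB j" using y0 j by (intro PiE_restrict) auto
      have "restrict y0 {1..Suc j} = (restrict y0 {1..j})(Suc j := y0 (Suc j))"
        by (auto simp: fun_eq_iff restrict_def)
      then show ?thesis
        using restrict_fun_upd_Suc[OF y] restrict_fun_upd_Suc[OF z] by (metis fun_upd_same)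
    qed
    have "(\<Sum>b\<in>B (Suc j). p (Suc j) x (y(Suc j := b)))
        = (\<Sum>b\<in>B (Suc j). if b = y0 (Suc j) then of_bool (y = restrict y0 {1..j}) else 0)"
      unfolding p_def upd by (intro sum.cong refl) auto
    also have "\<dots> = of_bool (y = restrict y0 {1..j})"
      using j y0 finB[of "Suc j"] by (auto simp: PiE_def Pi_def)
    also have "\<dots> = weight p j (restrict x {1..j}) y"
      using y by (auto simp: weight_def p_def)
    finally show "(\<Sum>b\<in>B (Suc j). p (Suc j) x (y(Suc j := b))) = weight p j (restrict x {1..j}) y" .
  qed (simp add: p_def)
  then show ?thesis by blast
qed

text \<open>A cheating vector is a function on infinitely many coordinates, so the polytope as such is
  unbounded. Clipped to the coordinates that occur in the constraints, it is a closed subset of a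
  product of unit intervals, which is compact by Tychonoff's theorem.\<close>

lemma objective_attains_max: "\<exists>p\<in>cheats. \<forall>q\<in>cheats. objective q \<le> objective p"
proof -
  define clip :: "('a, 'b) cheat_vec \<Rightarrow> ('a, 'b) cheat_vec" where
    "clip p = (\<lambda>j x y. if j \<in> {1..n} \<and> x \<in> PA j \<and> y \<in> PB j then p j x y else 0)" for p
  define K :: "('a, 'b) cheat_vec set" where
    "K = (\<Pi>\<^sub>E j\<in>UNIV. \<Pi>\<^sub>E x\<in>UNIV. \<Pi>\<^sub>E y\<in>UNIV. {0..1})"
  have "compact K" unfolding K_def by (intro compact_PiE_UNIV) simp
  have cont: "continuous_on S (\<lambda>p::('a, 'b) cheat_vec. p j x y)" for S j x y
    by (rule continuous_on_product_then_coordinatewise[where f = "\<lambda>p. p j x"],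
        rule continuous_on_product_then_coordinatewise[where f = "\<lambda>p. p j"],
        rule continuous_on_product_then_coordinatewise[where f = "\<lambda>p. p"], rule continuous_on_id)
  have cont_weight: "continuous_on S (\<lambda>p::('a, 'b) cheat_vec. weight p j x y)" for S j x y
    by (cases "j = 0") (simp_all add: weight_def cont)
  have closed: "closed cheats"
  proof -
    have "cheats = {p.
      (\<forall>j\<in>{1..n}. \<forall>x\<in>PA j. \<forall>y\<in>PB j. 0 \<le> p j x y) \<and>
      (\<forall>j<n. \<forall>x\<in>PA (Suc j). \<forall>y\<in>PB j.
       (\<Sum>b\<in>B (Suc j). p (Suc j) x (y(Suc j := b))) = weight p j (restrict x {1..j}) y)}"
      by (intro set_eqI) (simp only: mem_Collect_eq polytope_iff)
    also have "closed \<dots>"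
      unfolding Ball_def
      by (intro closed_Collect_conj closed_Collect_all closed_Collect_imp open_Collect_const
          closed_Collect_le closed_Collect_eq continuous_intros cont cont_weight)
    finally show ?thesis .
  qed
  have "compact (K \<inter> cheats)"
    using \<open>compact K\<close> closed by (rule compact_Int_closed)
  have clip: "clip p \<in> K \<inter> cheats" "objective (clip p) = objective p" if p: "p \<in> cheats" for p
  proof -
    have w: "weight (clip p) j x y = weight p j x y" if "j \<le> n" "x \<in> PA j" "y \<in> PB j" for j x y
      using that by (auto simp: weight_def clip_def)
    have "clip p \<in> K"
      using weight_nonneg[OF p] weight_le_1[OF p]
      by (force simp: K_def clip_def weight_def split: if_splits)
    moreover have "clip p \<in> cheats"
      unfolding polytope_iff
    proof (intro conjI ballI allI impI)
      fix j x y assume *: "j < n" "x \<in> PA (Suc j)" "y \<in> PB j"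
      have "(\<Sum>b\<in>B (Suc j). clip p (Suc j) x (y(Suc j := b))) = (\<Sum>b\<in>B (Suc j). weight p (Suc j) x (y(Suc j := b)))"
        using * PiE_fun_upd_Suc[of y j B] by (intro sum.cong refl) (auto simp: clip_def weight_def)
      also have "\<dots> = weight (clip p) j (restrict x {1..j}) y"
        using * PiE_restrict[of x "Suc j" A j] by (simp add: sum_weight_Suc[OF p] w)
      finally show "(\<Sum>b\<in>B (Suc j). clip p (Suc j) x (y(Suc j := b))) = weight (clip p) j (restrict x {1..j}) y" .
    qed (use p in \<open>auto simp: clip_def polytope_iff\<close>)
    ultimately show "clip p \<in> K \<inter> cheats" by simp
    have "fidelity (PB n) (reduced_vec n A (\<alpha> a) (clip p)) q = fidelity (PB n) (reduced_vec n A (\<alpha> a) p) q" for a q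
      unfolding reduced_vec_def using n by (intro fidelity_cong sum.cong refl) (simp add: clip_def)
    then show "objective (clip p) = objective p" by (simp add: bob_objective_def)
  qed
  have "K \<inter> cheats \<noteq> {}" using polytope_nonempty clip(1) by blast
  moreover have "continuous_on (K \<inter> cheats) objective"
    unfolding bob_objective_def[abs_def] fidelity_def reduced_vec_def by (intro continuous_intros cont)
  ultimately obtain p where p: "p \<in> K \<inter> cheats" "\<And>q. q \<in> K \<inter> cheats \<Longrightarrow> objective q \<le> objective p"
    using continuous_attains_sup[OF \<open>compact (K \<inter> cheats)\<close>] by blast
  show ?thesis
  proof (intro bexI ballI)
    fix q assume "q \<in> cheats"
    then show "objective q \<le> objective p" using p(2)[OF clip(1)] clip(2) by metis
  qed (use p in simp)
qed

end

section \<open>Bob's state conditioned on the messages\<close>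

text \<open>Bob's unnormalised state after round \<open>j\<close> when he has received the basis states \<open>x\<close> and
  his messages have been measured with results \<open>y\<close>.\<close>

primrec bob_state ::
  "('a, 'b) bob_strategy \<Rightarrow> nat \<Rightarrow> (nat \<Rightarrow> 'a) \<Rightarrow> (nat \<Rightarrow> 'b) \<Rightarrow> nat cmat" where
  "bob_state s 0 x y = init_state s"
| "bob_state s (Suc j) x y = (\<lambda>w w'. round_op s (Suc j)
     (tensor (bob_state s j (restrict x {1..j}) (restrict y {1..j})) (outer (basis_vec (x (Suc j)))))
     (y (Suc j), w) (y (Suc j), w'))"

definition bob_weight :: "('a, 'b) bob_strategy \<Rightarrow> ('a, 'b) cheat_vec" where
  "bob_weight s j x y = Re (trace_on (wspace s j) (bob_state s j x y))"

lemma purification_apply: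
  "finite S \<Longrightarrow> purification S p (u, v) = (if u = v \<and> u \<in> S then complex_of_real (sqrt (p u)) else 0)"
proof -
  assume "finite S"
  have "purification S p (u, v) = (\<Sum>x\<in>S. if x = u then (if u = v then complex_of_real (sqrt (p u)) else 0) else 0)"
    unfolding purification_def prod.case basis_vec_def by (intro sum.cong refl) auto
  then show ?thesis using \<open>finite S\<close> by auto
qed

lemma PiE_fun_upd_greaterThan:
  "x \<in> Pi\<^sub>E {Suc j<..n} A \<Longrightarrow> u \<in> A (Suc j) \<Longrightarrow> Suc j \<le> n \<Longrightarrow> x(Suc j := u) \<in> Pi\<^sub>E {j<..n} A"
  by (auto simp: PiE_def Pi_def extensional_def)

lemma fun_upd_eq_restrict_iff:
  assumes "x \<in> Pi\<^sub>E {Suc j<..n} A" "Suc j \<le> n"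
  shows "x(Suc j := u) = restrict x' {j<..n} \<longleftrightarrow> x = restrict x' {Suc j<..n} \<and> u = x' (Suc j)"
proof
  assume eq: "x(Suc j := u) = restrict x' {j<..n}"
  have "x i = restrict x' {Suc j<..n} i" for i
    using fun_cong[OF eq, of i] assms by (auto simp: PiE_def extensional_def split: if_splits)
  moreover have "u = x' (Suc j)" using fun_cong[OF eq, of "Suc j"] assms by simp
  ultimately show "x = restrict x' {Suc j<..n} \<and> u = x' (Suc j)" by auto
next
  assume "x = restrict x' {Suc j<..n} \<and> u = x' (Suc j)"
  then show "x(Suc j := u) = restrict x' {j<..n}" using assms by (auto simp: fun_eq_iff)
qed

context coin_flipping
begin

abbreviation "regs i k \<equiv> alice_regs n A B i k"

lemma finite_regs: "k \<le> n \<Longrightarrow> finite (regs i k)"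
  unfolding alice_regs_def by (intro finite_cartesian_product finite_UNIV_bit finite_PiE) (auto intro: finA finB)

lemma alice_psi_apply:
  "alice_psi n A \<alpha> (a0, a0', x, x') =
     (if a0 = a0' \<and> x = x' \<and> x \<in> PA n then complex_of_real (sqrt (\<alpha> a0 x) / sqrt 2) else 0)"
proof -
  have "alice_psi n A \<alpha> (a0, a0', x, x') = (\<Sum>a\<in>UNIV. if a = a0 then
     (if a0 = a0' then complex_of_real (1 / sqrt 2) * purification (PA n) (\<alpha> a0) (x, x') else 0) else 0)"
    unfolding alice_psi_def prod.case UNIV_bit basis_vec_def by (intro sum.cong refl) auto
  then show ?thesis by (auto simp: purification_apply finite_PA)
qed

context
  fixes s :: "('a, 'b) bob_strategy"
  assumes s: "valid_strategy n A B s"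
begin

abbreviation "W j \<equiv> wspace s j"

lemma init_state_density: "psd_on (W 0) (init_state s)" "trace_on (W 0) (init_state s) = 1"
  using s by (auto simp: valid_strategy_def density_on_def)

lemma quantum_op_round: "j < n \<Longrightarrow> quantum_op (W j \<times> A (Suc j)) (B (Suc j) \<times> W (Suc j)) (round_op s (Suc j))"
  using s by (auto simp: valid_strategy_def dest!: bspec[of _ _ "Suc j"])

lemma quantum_op_last: "quantum_op (W n \<times> UNIV \<times> PA n) ((UNIV \<times> PB n) \<times> W (n + 1)) (last_op s)"
  using s by (auto simp: valid_strategy_def)

lemma finAB: "j < n \<Longrightarrow> finite (A (Suc j))" "j < n \<Longrightarrow> finite (B (Suc j))"
  using finA finB by auto

lemma psd_bob_state:
  "j \<le> n \<Longrightarrow> x \<in> PA j \<Longrightarrow> y \<in> PB j \<Longrightarrow> psd_on (W j) (bob_state s j x y)"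
proof (induction j arbitrary: x y)
  case 0
  then show ?case by (simp add: init_state_density)
next
  case (Suc j)
  then have j: "j < n" by simp
  have x: "x (Suc j) \<in> A (Suc j)" and y: "y (Suc j) \<in> B (Suc j)" using Suc.prems by auto
  define X where "X = tensor (bob_state s j (restrict x {1..j}) (restrict y {1..j})) (outer (basis_vec (x (Suc j))))"
  have "psd_on (W j) (bob_state s j (restrict x {1..j}) (restrict y {1..j}))"
    using Suc.prems by (intro Suc.IH PiE_restrict[of _ "Suc j"]) auto
  then have "psd_on (W j \<times> A (Suc j)) X"
    unfolding X_def by (rule psd_on_tensor_outer_right) (use x j finAB in \<open>auto simp: basis_vec_def\<close>)
  then have psd: "psd_on (B (Suc j) \<times> W (Suc j)) (round_op s (Suc j) X)"
    by (rule quantum_op_psd[OF quantum_op_round[OF j]]) (use j finAB in auto)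
  have "psd_on (W (Suc j)) (relabel (W (Suc j)) (Pair (y (Suc j))) (round_op s (Suc j) X))"
    by (rule psd_on_relabel[OF psd]) (use y j finAB in auto)
  also have "relabel (W (Suc j)) (Pair (y (Suc j))) (round_op s (Suc j) X) = bob_state s (Suc j) x y"
    using psd_on_mats[OF psd] by (auto simp: relabel_def fun_eq_iff mats_def X_def)
  finally show ?case .
qed

text \<open>Summing over the reply of round \<open>j + 1\<close> gives the trace of the whole output of Bob's
  operation in that round, and hence the trace of its input.\<close>

lemma bob_weight_in_polytope: "bob_weight s \<in> cheats"
  unfolding polytope_iff
proof (intro conjI ballI allI impI)
  fix j x y assume "j \<in> {1..n}" "x \<in> PA j" "y \<in> PB j"
  then have "trace_on (W j) (bob_state s j x y) \<in> \<real>\<^sub>\<ge>\<^sub>0" by (intro psd_on_trace psd_bob_state) auto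
  then show "0 \<le> bob_weight s j x y" by (simp add: bob_weight_def complex_nonneg_Reals_iff)
next
  fix j x y assume j: "j < n" and x: "x \<in> PA (Suc j)" and y: "y \<in> PB j"
  define \<sigma> where "\<sigma> = bob_state s j (restrict x {1..j}) y"
  define X where "X = tensor \<sigma> (outer (basis_vec (x (Suc j))))"
  have xA: "x (Suc j) \<in> A (Suc j)" using x by auto
  have \<sigma>: "psd_on (W j) \<sigma>"
    unfolding \<sigma>_def using x y j by (intro psd_bob_state PiE_restrict[of _ "Suc j"]) auto
  then have X: "psd_on (W j \<times> A (Suc j)) X"
    unfolding X_def by (rule psd_on_tensor_outer_right) (use xA j finAB in \<open>auto simp: basis_vec_def\<close>)
  have "(\<Sum>b\<in>B (Suc j). bob_weight s (Suc j) x (y(Suc j := b)))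
      = Re (\<Sum>b\<in>B (Suc j). \<Sum>w\<in>W (Suc j). round_op s (Suc j) X (b, w) (b, w))"
    by (simp add: bob_weight_def trace_on_def X_def \<sigma>_def restrict_fun_upd_Suc[OF y])
  also have "\<dots> = Re (trace_on (B (Suc j) \<times> W (Suc j)) (round_op s (Suc j) X))"
    by (simp add: trace_on_def sum.cartesian_product')
  also have "\<dots> = Re (trace_on (W j \<times> A (Suc j)) X)"
    by (simp add: quantum_op_trace[OF quantum_op_round[OF j] psd_on_mats[OF X]])
  also have "trace_on (W j \<times> A (Suc j)) X = (\<Sum>w\<in>W j. \<Sum>u\<in>A (Suc j). if u = x (Suc j) then \<sigma> w w else 0)"
    unfolding trace_on_def sum.cartesian_product'
    by (intro sum.cong refl) (auto simp: X_def tensor_def outer_def basis_vec_def)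
  also have "\<dots> = trace_on (W j) \<sigma>"
    using xA finAB(1)[OF j] by (simp add: trace_on_def)
  also have "Re (trace_on (W j) \<sigma>) = weight (bob_weight s) j (restrict x {1..j}) y"
    using init_state_density(2) by (auto simp: weight_def bob_weight_def \<sigma>_def)
  finally show "(\<Sum>b\<in>B (Suc j). bob_weight s (Suc j) x (y(Suc j := b)))
      = weight (bob_weight s) j (restrict x {1..j}) y" .
qed

abbreviation "J \<equiv> joint_state n A B \<alpha> s"

lemma psd_joint_state: "j \<le> n \<Longrightarrow> psd_on (regs j j \<times> W j) (J j)"
proof (induction j)
  case 0
  have "relabel (regs 0 0) (\<lambda>(a0, a0', x, x', y). (a0, a0', x, x')) (outer (alice_psi n A \<alpha>))
      = outer (\<lambda>e. if e \<in> regs 0 0 then alice_psi n A \<alpha> ((\<lambda>(a0, a0', x, x', y). (a0, a0', x, x')) e) else 0)"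
    by (auto simp: relabel_def outer_def fun_eq_iff)
  then show ?case unfolding joint_state.simps
    by (simp only:) (rule psd_on_tensor_outer, rule init_state_density, simp)
next
  case (Suc j)
  then have j: "j < n" by simp
  define sent where "sent = relabel (regs (Suc j) j \<times> W j \<times> A (Suc j))
                   (\<lambda>((a0, a0', x, x', y), (w, u)). ((a0, a0', x(Suc j := u), x', y), w)) (J j)"
  have "psd_on (regs (Suc j) j \<times> W j \<times> A (Suc j)) sent"
    unfolding sent_def
  proof (rule psd_on_relabel)
    show "psd_on (regs j j \<times> W j) (J j)" using Suc by simp
    show "(\<lambda>((a0, a0', x, x', y), (w, u)). ((a0, a0', x(Suc j := u), x', y), w)) `
        (regs (Suc j) j \<times> W j \<times> A (Suc j)) \<subseteq> regs j j \<times> W j"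
      using j by (auto simp: alice_regs_def simp del: fun_upd_apply del: PiE_I intro!: PiE_fun_upd_greaterThan)
  qed (use j finAB finite_regs in auto)
  then have *: "psd_on (regs (Suc j) j \<times> B (Suc j) \<times> W (Suc j)) (ampliate (round_op s (Suc j)) sent)"
    by (rule psd_on_ampliate[OF quantum_op_round[OF j]]) (use j finAB finite_regs in auto)
  show ?case
    unfolding joint_state.simps Let_def sent_def[symmetric]
  proof (rule psd_on_relabel[OF *])
    show "(\<lambda>((a0, a0', x, x', y), w). ((a0, a0', x, x', restrict y {1..j}), (y (Suc j), w))) `
      (regs (Suc j) (Suc j) \<times> W (Suc j)) \<subseteq> regs (Suc j) j \<times> B (Suc j) \<times> W (Suc j)"
      using PiE_restrict[of _ "Suc j" B j] by (auto simp: alice_regs_def)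
  qed (use j finAB finite_regs Suc.prems in auto)
qed

text \<open>Only the blocks with the same \<open>a\<close>, the same copy \<open>x'\<close> and the same \<open>y\<close> on both sides are
  needed to trace out \<open>A\<^sub>0'\<close> and \<open>A'\<close>. On these blocks Bob has received basis states, so each of
  his operations acts as in \<open>bob_state\<close>, and \<open>\<alpha>\<close> enters only as a factor.\<close>

lemma joint_state_block:
  "j \<le> n \<Longrightarrow> x \<in> Pi\<^sub>E {j<..n} A \<Longrightarrow> x2 \<in> Pi\<^sub>E {j<..n} A \<Longrightarrow> x' \<in> PA n \<Longrightarrow> y \<in> PB j \<Longrightarrow>
   J j ((a0, a0', x, x', y), w) ((a0, a0', x2, x', y), w') =
     (if a0 = a0' \<and> x = restrict x' {j<..n} \<and> x2 = restrict x' {j<..n}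
      then complex_of_real (\<alpha> a0 x' / 2) * bob_state s j (restrict x' {1..j}) y w w' else 0)"
proof (induction j arbitrary: x x2 y w w')
  case 0
  have 1: "{0<..n} = {1..n}" by auto
  have 2: "restrict x' {1..n} = x'" using 0 by (auto simp: PiE_def extensional_restrict)
  have 3: "(a, a', z, x', y) \<in> regs 0 0" if "z \<in> PA n" for a a' z
    using 0 that unfolding alice_regs_def 1 by auto
  have 4: "complex_of_real (sqrt (\<alpha> a x')) * complex_of_real (sqrt (\<alpha> a x')) = complex_of_real (\<alpha> a x')" for a
    using \<alpha>_nonneg[OF 0(4), of a] by (simp flip: of_real_mult)
  have 5: "complex_of_real (sqrt 2) * complex_of_real (sqrt 2) = 2" by (simp flip: of_real_mult)
  have "alice_psi n A \<alpha> (a0, a0', x, x') * cnj (alice_psi n A \<alpha> (a0, a0', x2, x'))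
     = (if a0 = a0' \<and> x = x' \<and> x2 = x' then complex_of_real (\<alpha> a0 x' / 2) else 0)"
    using 0(4) by (auto simp: alice_psi_apply 4 5)
  then show ?case using 0 3[of x a0 a0'] 3[of x2 a0 a0'] unfolding 1 2 joint_state.simps
    by (simp add: tensor_def relabel_def outer_def)
next
  case (Suc j)
  then have j: "j < n" by simp
  define sent where "sent = relabel (regs (Suc j) j \<times> W j \<times> A (Suc j))
                   (\<lambda>((a0, a0', x, x', y), (w, u)). ((a0, a0', x(Suc j := u), x', y), w)) (J j)"
  define C where "C \<longleftrightarrow> a0 = a0' \<and> x = restrict x' {Suc j<..n} \<and> x2 = restrict x' {Suc j<..n}"
  define y0 \<sigma> z where "y0 = restrict y {1..j}" and "\<sigma> = bob_state s j (restrict x' {1..j}) y0"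
    and "z = (if C then complex_of_real (\<alpha> a0 x' / 2) else 0)"
  let ?X = "tensor \<sigma> (outer (basis_vec (x' (Suc j))))"
  have x'A: "x' (Suc j) \<in> A (Suc j)" using Suc.prems j by auto
  have y0: "y0 \<in> PB j" unfolding y0_def using Suc.prems by (intro PiE_restrict[of _ "Suc j"]) auto
  have x'j: "restrict x' {1..j} \<in> PA j" using Suc.prems by (intro PiE_restrict) auto
  have \<sigma>: "psd_on (W j) \<sigma>" unfolding \<sigma>_def using j x'j y0 by (intro psd_bob_state) auto
  have X: "psd_on (W j \<times> A (Suc j)) ?X"
    using \<sigma> by (rule psd_on_tensor_outer_right) (use x'A j finAB in \<open>auto simp: basis_vec_def\<close>)
  have regs: "(a0, a0', v, x', y0) \<in> regs (Suc j) j" if "v \<in> Pi\<^sub>E {Suc j<..n} A" for v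
    using that Suc.prems y0 by (auto simp: alice_regs_def)
  \<comment> \<open>On such a block, sending the message \<open>j + 1\<close> hands Bob the basis state \<open>x\'\<^bsub>j+1\<^esub>\<close>.\<close>
  have block: "sent ((a0, a0', x, x', y0), t) ((a0, a0', x2, x', y0), t') = z * ?X t t'" for t t'
  proof -
    obtain v u v' u' where t: "t = (v, u)" "t' = (v', u')" by (cases t, cases t')
    show ?thesis
    proof (cases "t \<in> W j \<times> A (Suc j) \<and> t' \<in> W j \<times> A (Suc j)")
      case True
      then have "sent ((a0, a0', x, x', y0), t) ((a0, a0', x2, x', y0), t')
          = J j ((a0, a0', x(Suc j := u), x', y0), v) ((a0, a0', x2(Suc j := u'), x', y0), v')"
        using regs Suc.prems by (simp add: sent_def relabel_def t)
      also have "\<dots> = (if a0 = a0' \<and> x(Suc j := u) = restrict x' {j<..n} \<and> x2(Suc j := u') = restrict x' {j<..n}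
        then complex_of_real (\<alpha> a0 x' / 2) * \<sigma> v v' else 0)"
        unfolding \<sigma>_def using True t j Suc.prems y0
        by (intro Suc.IH PiE_fun_upd_greaterThan) auto
      also have "\<dots> = z * ?X t t'"
        using fun_upd_eq_restrict_iff[OF Suc.prems(2,1)] fun_upd_eq_restrict_iff[OF Suc.prems(3,1)]
        by (auto simp: z_def C_def t tensor_def outer_def basis_vec_def)
      finally show ?thesis .
    next
      case False
      then have "?X t t' = 0" using psd_on_mats[OF X] unfolding mats_def by blast
      moreover have "sent ((a0, a0', x, x', y0), t) ((a0, a0', x2, x', y0), t') = 0"
        using False by (auto simp: sent_def relabel_def)
      ultimately show ?thesis by simp
    qed
  qed
  have bs: "bob_state s (Suc j) (restrict x' {1..Suc j}) y w w'
      = round_op s (Suc j) ?X (y (Suc j), w) (y (Suc j), w')" for w w'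
  proof -
    have "restrict (restrict x' {1..Suc j}) {1..j} = restrict x' {1..j}" by (auto simp: fun_eq_iff)
    then show ?thesis by (simp add: \<sigma>_def y0_def)
  qed
  show ?case
  proof (cases "w \<in> W (Suc j) \<and> w' \<in> W (Suc j)")
    case True
    then have "J (Suc j) ((a0, a0', x, x', y), w) ((a0, a0', x2, x', y), w')
      = ampliate (round_op s (Suc j)) sent ((a0, a0', x, x', y0), (y (Suc j), w)) ((a0, a0', x2, x', y0), (y (Suc j), w'))"
      unfolding joint_state.simps Let_def sent_def[symmetric] using Suc.prems
      by (simp add: relabel_def alice_regs_def y0_def)
    also have "\<dots> = round_op s (Suc j) (\<lambda>t t'. z * ?X t t') (y (Suc j), w) (y (Suc j), w')"
      by (simp add: ampliate_def block)
    also have "\<dots> = z * round_op s (Suc j) ?X (y (Suc j), w) (y (Suc j), w')"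
      by (simp add: quantum_op_scale[OF quantum_op_round[OF j] psd_on_mats[OF X]])
    finally have "J (Suc j) ((a0, a0', x, x', y), w) ((a0, a0', x2, x', y), w')
      = z * round_op s (Suc j) ?X (y (Suc j), w) (y (Suc j), w')" .
    then show ?thesis unfolding bs C_def[symmetric] by (simp add: z_def del: joint_state.simps)
  next
    case False
    then have "J (Suc j) ((a0, a0', x, x', y), w) ((a0, a0', x2, x', y), w') = 0"
      unfolding joint_state.simps Let_def by (auto simp: relabel_def)
    moreover have "bob_state s (Suc j) (restrict x' {1..Suc j}) y w w' = 0"
      using False psd_on_mats[OF psd_bob_state[of "Suc j" "restrict x' {1..Suc j}" y]]
        Suc.prems PiE_restrict[of x' n A "Suc j"] unfolding mats_def by blast
    ultimately show ?thesis by (simp del: bob_state.simps)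
  qed
qed

end
end

section \<open>Alice's acceptance probability\<close>

context coin_flipping
begin

text \<open>\<open>e\<^bsub>b\<oplus>c\<^esub> \<otimes> e\<^sub>b \<otimes> \<phi>\<^sub>b\<close>\<close>

definition alice_vec :: "bit \<Rightarrow> bit \<times> bit \<times> (nat \<Rightarrow> 'b) \<times> (nat \<Rightarrow> 'b) \<Rightarrow> complex" where
  "alice_vec b = (\<lambda>(a0, b0, y, y').
    if a0 = b + c \<and> b0 = b \<and> y = y' \<and> y \<in> PB n then complex_of_real (sqrt (\<beta> b y)) else 0)"

lemma alice_proj_apply:
  "alice_proj n B \<beta> c r r' = (\<Sum>b\<in>UNIV. alice_vec b r * alice_vec b r')"
  unfolding alice_proj_def UNIV_bit alice_vec_def
  by (intro sum.cong refl)
    (auto simp: tensor_def outer_def basis_vec_def purification_apply finite_PB split: prod.splits)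

text \<open>The operators of Bob's measurement sum to the identity, so his register is traced out. As
  \<open>\<phi>\<^sub>b\<close> is supported on equal labels, only the entries with \<open>y, y\<close> and \<open>y', y'\<close> are left.\<close>

lemma accept_prob_eq:
  assumes povm: "povm (wspace s (n + 1)) (num_outcomes s) (final_meas s)"
  shows "accept_prob n A B \<alpha> \<beta> c s =
    (\<Sum>b\<in>UNIV. \<Sum>y\<in>PB n. \<Sum>y'\<in>PB n. sqrt (\<beta> b y) * sqrt (\<beta> b y') *
       (\<Sum>w\<in>wspace s (n + 1). Re (final_state n A B \<alpha> s ((b + c, b, y, y), w) ((b + c, b, y', y'), w))))"
proof -
  define F where "F = final_state n A B \<alpha> s"
  define PJ where "PJ = alice_proj n B \<beta> c"
  define R where "R = final_regs n B"
  define W where "W = wspace s (n + 1)"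
  define M where "M = final_meas s"
  define G where "G r' r = (\<Sum>w\<in>W. F (r', w) (r, w))" for r r'
  define v where "v = alice_vec"
  have R: "finite R" unfolding R_def final_regs_def
    by (intro finite_cartesian_product finite_UNIV_bit finite_PB order.refl)
  have idm: "(\<Sum>k<num_outcomes s. M k w w') = (if w = w' then 1 else 0)" if "w \<in> W" for w w'
    using povm that by (auto simp: povm_def M_def W_def id_mat_def fun_eq_iff)
  have vsum: "(\<Sum>r\<in>R. v b r * f r) = (\<Sum>y\<in>PB n. complex_of_real (sqrt (\<beta> b y)) * f (b + c, b, y, y))" for b f
  proof -
    have "(\<Sum>r\<in>R. v b r * f r) = (\<Sum>y\<in>PB n. v b (b + c, b, y, y) * f (b + c, b, y, y))"
      by (rule sum_image_support[OF R])
        (auto simp: inj_on_def R_def final_regs_def v_def alice_vec_def)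
    then show ?thesis by (simp add: v_def alice_vec_def)
  qed
  have "(\<Sum>k<num_outcomes s. trace_on (R \<times> W) (mat_prod (R \<times> W) (tensor PJ (M k)) F))
      = (\<Sum>k<num_outcomes s. \<Sum>i\<in>R \<times> W. \<Sum>j\<in>R \<times> W. tensor PJ (M k) i j * F j i)"
    by (simp add: trace_on_def mat_prod_def)
  also have "\<dots> = (\<Sum>i\<in>R \<times> W. \<Sum>k<num_outcomes s. \<Sum>j\<in>R \<times> W. tensor PJ (M k) i j * F j i)"
    by (rule sum.swap)
  also have "\<dots> = (\<Sum>i\<in>R \<times> W. \<Sum>j\<in>R \<times> W. \<Sum>k<num_outcomes s. tensor PJ (M k) i j * F j i)"
    by (intro sum.cong refl sum.swap)
  also have "\<dots> = (\<Sum>r\<in>R. \<Sum>w\<in>W. \<Sum>r'\<in>R. \<Sum>w'\<in>W. PJ r r' * (\<Sum>k<num_outcomes s. M k w w') * F (r', w') (r, w))"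
    unfolding sum.cartesian_product' by (simp add: tensor_def sum_distrib_left sum_distrib_right)
  also have "\<dots> = (\<Sum>r\<in>R. \<Sum>w\<in>W. \<Sum>r'\<in>R. \<Sum>w'\<in>W. if w = w' then PJ r r' * F (r', w) (r, w) else 0)"
    by (intro sum.cong refl) (simp add: idm)
  also have "\<dots> = (\<Sum>r\<in>R. \<Sum>w\<in>W. \<Sum>r'\<in>R. PJ r r' * F (r', w) (r, w))"
    by (simp add: W_def)
  also have "\<dots> = (\<Sum>r\<in>R. \<Sum>r'\<in>R. \<Sum>w\<in>W. PJ r r' * F (r', w) (r, w))"
    by (intro sum.cong refl sum.swap)
  also have "\<dots> = (\<Sum>r\<in>R. \<Sum>r'\<in>R. \<Sum>b\<in>UNIV. v b r * (v b r' * G r' r))"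
    unfolding PJ_def alice_proj_apply v_def[symmetric]
    by (simp add: G_def sum_distrib_left sum_distrib_right mult.assoc)
       (intro sum.cong refl sum.swap)
  also have "\<dots> = (\<Sum>r\<in>R. \<Sum>b\<in>UNIV. \<Sum>r'\<in>R. v b r * (v b r' * G r' r))"
    by (intro sum.cong refl sum.swap)
  also have "\<dots> = (\<Sum>b\<in>UNIV. \<Sum>r\<in>R. \<Sum>r'\<in>R. v b r * (v b r' * G r' r))"
    by (rule sum.swap)
  also have "\<dots> = (\<Sum>b\<in>UNIV. \<Sum>y\<in>PB n. \<Sum>y'\<in>PB n. complex_of_real (sqrt (\<beta> b y) * sqrt (\<beta> b y')) *
      G (b + c, b, y', y') (b + c, b, y, y))"
    by (simp add: sum_distrib_left[symmetric] vsum) (simp add: sum_distrib_left mult.assoc)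
  also have "\<dots> = (\<Sum>b\<in>UNIV. \<Sum>y'\<in>PB n. \<Sum>y\<in>PB n. complex_of_real (sqrt (\<beta> b y) * sqrt (\<beta> b y')) *
      G (b + c, b, y', y') (b + c, b, y, y))"
    by (intro sum.cong refl sum.swap)
  finally have "(\<Sum>k<num_outcomes s. Re (trace_on (R \<times> W) (mat_prod (R \<times> W) (tensor PJ (M k)) F)))
      = Re (\<Sum>b\<in>UNIV. \<Sum>y'\<in>PB n. \<Sum>y\<in>PB n. complex_of_real (sqrt (\<beta> b y) * sqrt (\<beta> b y')) *
      G (b + c, b, y', y') (b + c, b, y, y))" by (simp flip: Re_sum)
  also have "\<dots> = (\<Sum>b\<in>UNIV. \<Sum>y'\<in>PB n. \<Sum>y\<in>PB n. sqrt (\<beta> b y') * sqrt (\<beta> b y) *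
       (\<Sum>w\<in>W. Re (F ((b + c, b, y', y'), w) ((b + c, b, y, y), w))))"
    unfolding Re_sum by (intro sum.cong refl) (simp add: G_def flip: of_real_mult)
  finally show ?thesis
    by (simp add: accept_prob_def Let_def R_def W_def F_def M_def PJ_def)
qed

text \<open>Alice's branches are indexed by \<open>b = a \<oplus> c\<close>.\<close>

lemma objective_eq:
  "objective p = 1 / 2 * (\<Sum>b\<in>UNIV. fidelity (PB n) (reduced_vec n A (\<alpha> (b + c)) p) (\<beta> b))"
proof -
  have bit: "x + c + c = x" for x using bit_add_cancel[of "x + c" x c] by simp
  have "(\<Sum>b\<in>UNIV. fidelity (PB n) (reduced_vec n A (\<alpha> (b + c)) p) (\<beta> b))
    = (\<Sum>a\<in>UNIV. fidelity (PB n) (reduced_vec n A (\<alpha> a) p) (\<beta> (a + c)))"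
    by (rule sum.reindex_bij_witness[of _ "\<lambda>x. x + c" "\<lambda>x. x + c"]) (auto simp: bit)
  then show ?thesis by (simp add: bob_objective_def UNIV_bit)
qed

text \<open>On the branch \<open>a\<close>, the matrix \<open>G\<close> of the entries that Alice tests is positive
  semidefinite, so its form at \<open>\<surd>\<beta>\<^sub>b\<close> is at most the fidelity of its diagonal with \<open>\<beta>\<^sub>b\<close>. The
  diagonal entry at \<open>y\<close> is part of the trace of the output of Bob's last operation on the block
  of \<open>a, y\<close>, and the trace of the input is given by \<open>joint_state_block\<close>.\<close>

lemma accept_prob_le_objective:
  assumes s: "valid_strategy n A B s"
  shows "accept_prob n A B \<alpha> \<beta> c s \<le> objective (bob_weight s)"
proof -
  define W where "W = wspace s (n + 1)"
  define S where "S = wspace s n \<times> (UNIV :: bit set) \<times> PA n"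
  define T where "T = ((UNIV :: bit set) \<times> PB n) \<times> W"
  define E where "E = (UNIV :: bit set) \<times> PB n"
  define J where "J = joint_state n A B \<alpha> s n"
  define sent where "sent = relabel (E \<times> S) (\<lambda>((a0, y), (w, a0', x')). ((a0, a0', \<lambda>_. undefined, x', y), w)) J"
  define F where "F = final_state n A B \<alpha> s"
  have F: "F = relabel (final_regs n B \<times> W) (\<lambda>((a0, b0', y, y'), w). ((a0, y), ((b0', y'), w)))
      (ampliate (last_op s) sent)"
    by (simp add: F_def final_state_def Let_def sent_def S_def E_def W_def J_def)
  have fin: "finite S" "finite T" "finite E" "finite W" "finite (final_regs n B)"
    unfolding S_def T_def E_def W_def final_regs_def
    by (intro finite_cartesian_product finite_UNIV_bit finite_PB finite_PA order.refl finite_lessThan)+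
  have op: "quantum_op S T (last_op s)" using quantum_op_last[OF s] by (simp add: S_def T_def W_def)
  have sent: "psd_on (E \<times> S) sent"
    unfolding sent_def
  proof (rule psd_on_relabel)
    show "psd_on (regs n n \<times> wspace s n) J"
      unfolding J_def by (rule psd_joint_state[OF s]) simp
    show "finite (E \<times> S)" using fin by simp
    show "finite (regs n n \<times> wspace s n)" using finite_regs by simp
    show "(\<lambda>((a0, y), (w, a0', x')). ((a0, a0', \<lambda>_. undefined, x', y), w)) ` (E \<times> S) \<subseteq> regs n n \<times> wspace s n"
      by (auto simp: E_def S_def alice_regs_def)
  qed
  then have amp: "psd_on (E \<times> T) (ampliate (last_op s) sent)"
    by (rule psd_on_ampliate[OF op]) (use fin in auto)
  have psd_F: "psd_on (final_regs n B \<times> W) F"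
    unfolding F by (rule psd_on_relabel[OF amp]) (use fin in \<open>auto simp: E_def T_def final_regs_def\<close>)
  have branch: "(\<Sum>y\<in>PB n. \<Sum>y'\<in>PB n. sqrt (\<beta> b y) * sqrt (\<beta> b y') *
       (\<Sum>w\<in>W. Re (F ((a, b, y, y), w) ((a, b, y', y'), w))))
    \<le> 1 / 2 * fidelity (PB n) (reduced_vec n A (\<alpha> a) (bob_weight s)) (\<beta> b)" for a b
  proof -
    define G where "G = (\<lambda>y y'. \<Sum>w\<in>W. relabel (PB n) (\<lambda>y. ((a, b, y, y), w)) F y y')"
    have G: "psd_on (PB n) G"
      unfolding G_def by (intro psd_on_sum psd_on_relabel[OF psd_F])
        (use fin finite_PB in \<open>auto simp: final_regs_def\<close>)
    have diag: "Re (G y y) \<le> 1 / 2 * reduced_vec n A (\<alpha> a) (bob_weight s) y" if y: "y \<in> PB n" for y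
    proof -
      define X where "X = (\<lambda>t t'. sent ((a, y), t) ((a, y), t'))"
      have "psd_on S (relabel S (Pair (a, y)) sent)"
        by (rule psd_on_relabel[OF sent]) (use fin y in \<open>auto simp: E_def\<close>)
      also have "relabel S (Pair (a, y)) sent = X"
        using psd_on_mats[OF sent] by (auto simp: X_def relabel_def fun_eq_iff mats_def)
      finally have X: "psd_on S X" .
      have out: "psd_on T (last_op s X)" by (rule quantum_op_psd[OF op X]) (use fin in auto)
      have nonneg: "0 \<le> Re (last_op s X t t)" for t
        using psd_on_diag[OF out fin(2), of t] by (simp add: complex_nonneg_Reals_iff)
      have "Re (G y y) = (\<Sum>w\<in>W. Re (last_op s X ((b, y), w) ((b, y), w)))"
        unfolding G_def Re_sum using y
        by (intro sum.cong refl) (simp add: relabel_def F final_regs_def ampliate_def X_def)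
      also have "\<dots> = (\<Sum>t\<in>Pair (b, y) ` W. Re (last_op s X t t))"
        by (subst sum.reindex) (auto simp: inj_on_def)
      \<comment> \<open>The output need not have the label \<open>(b, y)\<close> in \<open>B\<^sub>0', B'\<close>; the missing part of the trace is nonnegative.\<close>
      also have "\<dots> \<le> (\<Sum>t\<in>T. Re (last_op s X t t))"
        using y fin nonneg by (intro sum_mono2) (auto simp: T_def)
      also have "\<dots> = Re (trace_on S X)"
        using quantum_op_trace[OF op psd_on_mats[OF X]] by (simp add: trace_on_def flip: Re_sum)
      also have "trace_on S X = (\<Sum>w\<in>wspace s n. \<Sum>a0'\<in>UNIV. \<Sum>x'\<in>PA n. if a0' = a then
          complex_of_real (\<alpha> a x' / 2) * bob_state s n x' y w w else 0)"
        unfolding trace_on_def S_def sum.cartesian_product'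
      proof (intro sum.cong refl)
        fix w a0' x' assume w: "w \<in> wspace s n" and x': "x' \<in> PA n"
        have 1: "restrict x' {n<..n} = (\<lambda>_. undefined)" by auto
        have 2: "restrict x' {1..n} = x'" using x' by (auto simp: PiE_def extensional_restrict)
        have "X (w, a0', x') (w, a0', x') = J ((a, a0', \<lambda>_. undefined, x', y), w) ((a, a0', \<lambda>_. undefined, x', y), w)"
          using w x' y by (simp add: X_def sent_def relabel_def E_def S_def)
        also have "\<dots> = (if a0' = a then complex_of_real (\<alpha> a x' / 2) * bob_state s n x' y w w else 0)"
          unfolding J_def by (subst joint_state_block[OF s]) (use x' y 1 2 in auto)
        finally show "X (w, a0', x') (w, a0', x')
          = (if a0' = a then complex_of_real (\<alpha> a x' / 2) * bob_state s n x' y w w else 0)" .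
      qed
      also have "\<dots> = (\<Sum>w\<in>wspace s n. \<Sum>x'\<in>PA n. complex_of_real (\<alpha> a x' / 2) * bob_state s n x' y w w)"
        by (subst sum.swap[of _ "PA n"]) (simp add: sum.delta)
      also have "\<dots> = (\<Sum>x'\<in>PA n. complex_of_real (\<alpha> a x' / 2) * trace_on (wspace s n) (bob_state s n x' y))"
        by (subst sum.swap) (simp add: trace_on_def sum_distrib_left)
      also have "Re \<dots> = 1 / 2 * reduced_vec n A (\<alpha> a) (bob_weight s) y"
        by (simp add: reduced_vec_def bob_weight_def sum_distrib_left del: of_real_divide)
      finally show ?thesis .
    qed
    have "(\<Sum>y\<in>PB n. \<Sum>y'\<in>PB n. sqrt (\<beta> b y) * sqrt (\<beta> b y') *
       (\<Sum>w\<in>W. Re (F ((a, b, y, y), w) ((a, b, y', y'), w))))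
      = (\<Sum>y\<in>PB n. \<Sum>y'\<in>PB n. sqrt (\<beta> b y) * sqrt (\<beta> b y') * Re (G y y'))"
      by (intro sum.cong refl) (simp add: G_def relabel_def)
    also have "\<dots> \<le> fidelity (PB n) (\<lambda>y. Re (G y y)) (\<beta> b)"
      unfolding fidelity_def
      by (rule psd_on_form_le[OF G]) (use finite_PB \<beta>_nonneg in auto)
    also have "\<dots> \<le> fidelity (PB n) (\<lambda>y. 1 / 2 * reduced_vec n A (\<alpha> a) (bob_weight s) y) (\<beta> b)"
      using psd_on_diag[OF G] finite_PB
      by (intro fidelity_mono diag \<beta>_nonneg) (auto simp: complex_nonneg_Reals_iff)
    also have "\<dots> = 1 / 2 * fidelity (PB n) (reduced_vec n A (\<alpha> a) (bob_weight s)) (\<beta> b)"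
      by (rule fidelity_scale) simp
    finally show ?thesis .
  qed
  have "accept_prob n A B \<alpha> \<beta> c s = (\<Sum>b\<in>UNIV. \<Sum>y\<in>PB n. \<Sum>y'\<in>PB n. sqrt (\<beta> b y) * sqrt (\<beta> b y') *
       (\<Sum>w\<in>W. Re (F ((b + c, b, y, y), w) ((b + c, b, y', y'), w))))"
    unfolding W_def F_def by (rule accept_prob_eq) (use s in \<open>simp add: valid_strategy_def\<close>)
  also have "\<dots> \<le> (\<Sum>b\<in>UNIV. 1 / 2 * fidelity (PB n) (reduced_vec n A (\<alpha> (b + c)) (bob_weight s)) (\<beta> b))"
    by (intro sum_mono branch)
  also have "\<dots> = objective (bob_weight s)"
    unfolding objective_eq by (simp add: sum_distrib_left)
  finally show ?thesis .
qed

end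

section \<open>The optimal strategy\<close>

context coin_flipping
begin

lemma PA_nonempty: "j \<le> n \<Longrightarrow> PA j \<noteq> {}"
proof -
  assume "j \<le> n"
  have "PA n \<noteq> {}" using sum_\<alpha>[of 0] by (intro notI) simp
  then obtain z where "z \<in> PA n" by blast
  from PiE_restrict[OF this \<open>j \<le> n\<close>] show ?thesis by blast
qed

lemma PB_nonempty: "j \<le> n \<Longrightarrow> PB j \<noteq> {}"
proof -
  assume "j \<le> n"
  have "PB n \<noteq> {}" using sum_\<beta>[of 0] by (intro notI) simp
  then obtain z where "z \<in> PB n" by blast
  from PiE_restrict[OF this \<open>j \<le> n\<close>] show ?thesis by blast
qed

abbreviation "hist j \<equiv> PA j \<times> PB j"
abbreviation "hdim j \<equiv> card (hist j)"

lemma finite_hist: "j \<le> n \<Longrightarrow> finite (hist j)"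
  by (simp add: finite_PA finite_PB)

lemma dim_pos: "j \<le> n \<Longrightarrow> 0 < hdim j"
  using finite_hist PA_nonempty PB_nonempty by (simp add: card_gt_0_iff)

end

text \<open>Bob's workspace after round \<open>j\<close> is spanned by the histories of the first \<open>j\<close> rounds. As a
  workspace is labelled by numbers, \<open>dec j\<close> enumerates these histories.\<close>

locale cheating_strategy = coin_flipping n A B \<alpha> \<beta> c
  for n :: nat
    and A :: "nat \<Rightarrow> 'a set" and B :: "nat \<Rightarrow> 'b set"
    and \<alpha> :: "bit \<Rightarrow> (nat \<Rightarrow> 'a) \<Rightarrow> real" and \<beta> :: "bit \<Rightarrow> (nat \<Rightarrow> 'b) \<Rightarrow> real"
    and c :: bit +
  fixes p :: "('a, 'b) cheat_vec" and dec :: "nat \<Rightarrow> nat \<Rightarrow> (nat \<Rightarrow> 'a) \<times> (nat \<Rightarrow> 'b)"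
  assumes p: "p \<in> cheats"
    and dec: "\<And>j. j \<le> n \<Longrightarrow> bij_betw (dec j) {..<hdim j} (hist j)"
begin

abbreviation "wt j q \<equiv> weight p j (fst q) (snd q)"
abbreviation "red a \<equiv> reduced_vec n A (\<alpha> a) p"

lemma dec_hist: "j \<le> n \<Longrightarrow> w < hdim j \<Longrightarrow> dec j w \<in> hist j"
  using bij_betwE[OF dec, of j] by simp

lemma dec_eq_iff: "j \<le> n \<Longrightarrow> w < hdim j \<Longrightarrow> w' < hdim j \<Longrightarrow> dec j w = dec j w' \<longleftrightarrow> w = w'"
  using inj_on_eq_iff[OF bij_betw_imp_inj_on[OF dec]] by simp

definition enc :: "nat \<Rightarrow> (nat \<Rightarrow> 'a) \<times> (nat \<Rightarrow> 'b) \<Rightarrow> nat" where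
  "enc j = inv_into {..<hdim j} (dec j)"

lemma enc: "j \<le> n \<Longrightarrow> q \<in> hist j \<Longrightarrow> enc j q < hdim j" "j \<le> n \<Longrightarrow> q \<in> hist j \<Longrightarrow> dec j (enc j q) = q"
proof -
  assume "j \<le> n" "q \<in> hist j"
  then have "q \<in> dec j ` {..<hdim j}" using dec[of j] by (simp add: bij_betw_def)
  from inv_into_into[OF this] f_inv_into_f[OF this]
  show "enc j q < hdim j" "dec j (enc j q) = q" by (simp_all add: enc_def)
qed

lemma wt_nonneg: "j \<le> n \<Longrightarrow> q \<in> hist j \<Longrightarrow> 0 \<le> wt j q"
  by (intro weight_nonneg[OF p]) (simp_all add: mem_Times_iff)

lemma wt_Suc_le:
  assumes "j < n" "x \<in> PA (Suc j)" "y \<in> PB (Suc j)"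
  shows "weight p (Suc j) x y \<le> weight p j (restrict x {1..j}) (restrict y {1..j})"
proof -
  let ?y = "restrict y {1..j}"
  have y: "?y \<in> PB j" using assms by (intro PiE_restrict[of _ "Suc j"]) auto
  have "weight p (Suc j) x (?y(Suc j := y (Suc j))) \<le> (\<Sum>b\<in>B (Suc j). weight p (Suc j) x (?y(Suc j := b)))"
  proof (rule member_le_sum[where f = "\<lambda>b. weight p (Suc j) x (?y(Suc j := b))"])
    show "y (Suc j) \<in> B (Suc j)" using assms(3) by (rule PiE_mem) simp
    show "finite (B (Suc j))" using assms(1) by (intro finB) simp
    fix b assume "b \<in> B (Suc j) - {y (Suc j)}"
    then show "0 \<le> weight p (Suc j) x (?y(Suc j := b))"
      using assms(1,2) by (intro weight_nonneg[OF p] PiE_fun_upd_Suc[OF y]) simp_all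
  qed
  then show ?thesis
    using sum_weight_Suc[OF p assms(1,2) y] by (simp only: restrict_fun_upd_same[OF assms(3)])
qed

definition extend :: "nat \<Rightarrow> (nat \<Rightarrow> 'a) \<times> (nat \<Rightarrow> 'b) \<Rightarrow> 'a \<Rightarrow> 'b \<Rightarrow> (nat \<Rightarrow> 'a) \<times> (nat \<Rightarrow> 'b)" where
  "extend j q u b = ((fst q)(Suc j := u), (snd q)(Suc j := b))"

lemma extend_hist: "q \<in> hist j \<Longrightarrow> u \<in> A (Suc j) \<Longrightarrow> b \<in> B (Suc j) \<Longrightarrow> extend j q u b \<in> hist (Suc j)"
  by (simp add: extend_def mem_Times_iff PiE_fun_upd_Suc del: fun_upd_apply)

lemma extend_inject:
  assumes "q \<in> hist j" "q' \<in> hist j"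
  shows "extend j q u b = extend j q' u' b' \<longleftrightarrow> q = q' \<and> u = u' \<and> b = b'"
proof
  assume eq: "extend j q u b = extend j q' u' b'"
  then have 1: "(fst q)(Suc j := u) = (fst q')(Suc j := u')" and 2: "(snd q)(Suc j := b) = (snd q')(Suc j := b')"
    by (simp_all add: extend_def)
  have "fst q = restrict ((fst q)(Suc j := u)) {1..j}"
    using assms by (intro restrict_fun_upd_Suc[symmetric, of _ _ A]) (simp add: mem_Times_iff)
  also have "\<dots> = fst q'"
    unfolding 1 using assms by (intro restrict_fun_upd_Suc[of _ _ A]) (simp add: mem_Times_iff)
  finally have "fst q = fst q'" .
  moreover have "snd q = restrict ((snd q)(Suc j := b)) {1..j}"
    using assms by (intro restrict_fun_upd_Suc[symmetric, of _ _ B]) (simp add: mem_Times_iff)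
  then have "snd q = snd q'"
    unfolding 2 using assms restrict_fun_upd_Suc[of "snd q'" j B b'] by (simp add: mem_Times_iff)
  moreover have "u = u'" "b = b'" using fun_cong[OF 1, of "Suc j"] fun_cong[OF 2, of "Suc j"] by simp_all
  ultimately show "q = q' \<and> u = u' \<and> b = b'" by (simp add: prod_eq_iff)
qed simp

text \<open>Amplitudes of round \<open>j + 1\<close>: Bob appends the received \<open>u\<close> to his record, chooses his reply
  in superposition with the conditional weights prescribed by \<open>p\<close>, and records it too. The quotient
  is zero on histories of weight zero, which makes the map a partial isometry.\<close>

definition round_amp :: "nat \<Rightarrow> 'b \<times> nat \<Rightarrow> nat \<times> 'a \<Rightarrow> complex" where
  "round_amp j = (\<lambda>(b, w') (w, u). if dec (Suc j) w' = extend j (dec j w) u b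
     then complex_of_real (sqrt (wt (Suc j) (dec (Suc j) w') / wt j (dec j w))) else 0)"

text \<open>Different inputs \<open>(q, u)\<close> lead to different records, so the columns of the amplitude matrix
  are orthogonal. Their norms are one by the constraint of the polytope, unless the history has
  weight zero.\<close>

lemma round_gram:
  assumes j: "j < n"
    and s: "s \<in> {..<hdim j} \<times> A (Suc j)" and r: "r \<in> {..<hdim j} \<times> A (Suc j)"
  shows "(\<Sum>t\<in>B (Suc j) \<times> {..<hdim (Suc j)}. cnj (round_amp j t s) * round_amp j t r)
    = (if s = r \<and> wt j (dec j (fst s)) \<noteq> 0 then 1 else 0)"
proof -
  obtain w u where sw: "s = (w, u)" by (cases s)
  let ?q = "dec j w"
  have q: "?q \<in> hist j" using dec_hist j s sw by auto
  have u: "u \<in> A (Suc j)" using s sw by auto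
  have finB': "finite (B (Suc j))" using finB j by auto
  show ?thesis
  proof (cases "s = r")
    case False
    have "cnj (round_amp j t s) * round_amp j t r = 0" if "t \<in> B (Suc j) \<times> {..<hdim (Suc j)}" for t
    proof -
      obtain w2 u2 b w' where rt: "r = (w2, u2)" "t = (b, w')" by (cases r, cases t)
      have "dec j w2 \<in> hist j" using dec_hist j r rt by auto
      then have "\<not> (dec (Suc j) w' = extend j (dec j w) u b \<and> dec (Suc j) w' = extend j (dec j w2) u2 b)"
        using extend_inject[OF q, of "dec j w2" u b u2 b] dec_eq_iff[of j w w2] False sw rt j s r by auto
      then show ?thesis by (auto simp: round_amp_def sw rt)
    qed
    then show ?thesis using False by (simp add: sum.neutral)
  next
    case True
    have ex: "extend j ?q u b \<in> hist (Suc j)" if "b \<in> B (Suc j)" for b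
      using extend_hist[OF q u that] .
    have "(\<Sum>t\<in>B (Suc j) \<times> {..<hdim (Suc j)}. cnj (round_amp j t s) * round_amp j t r)
      = (\<Sum>b\<in>B (Suc j). cnj (round_amp j (b, enc (Suc j) (extend j ?q u b)) s) * round_amp j (b, enc (Suc j) (extend j ?q u b)) r)"
    proof (rule sum_image_support)
      show "(\<lambda>b. (b, enc (Suc j) (extend j ?q u b))) ` B (Suc j) \<subseteq> B (Suc j) \<times> {..<hdim (Suc j)}"
        using enc(1)[OF _ ex] j by auto
      fix t assume t: "t \<in> B (Suc j) \<times> {..<hdim (Suc j)}"
        "t \<notin> (\<lambda>b. (b, enc (Suc j) (extend j ?q u b))) ` B (Suc j)"
      obtain b w' where bw: "t = (b, w')" by (cases t)
      have "dec (Suc j) w' \<noteq> extend j ?q u b"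
      proof
        assume "dec (Suc j) w' = extend j ?q u b"
        then have "dec (Suc j) w' = dec (Suc j) (enc (Suc j) (extend j ?q u b))"
          using enc(2)[OF _ ex, of b] t bw j by simp
        then have "w' = enc (Suc j) (extend j ?q u b)"
          using dec_eq_iff[of "Suc j"] enc(1)[OF _ ex, of b] t bw j by auto
        then show False using t bw by auto
      qed
      then show "cnj (round_amp j t s) * round_amp j t r = 0" by (simp add: round_amp_def bw sw)
    qed (use finB' in \<open>auto simp: inj_on_def\<close>)
    also have "\<dots> = (\<Sum>b\<in>B (Suc j). complex_of_real (wt (Suc j) (extend j ?q u b) / wt j ?q))"
    proof (intro sum.cong refl)
      fix b assume b: "b \<in> B (Suc j)"
      have "0 \<le> wt (Suc j) (extend j ?q u b) / wt j ?q"
        using wt_nonneg[OF _ ex[OF b]] wt_nonneg[OF _ q] j by (intro divide_nonneg_nonneg) auto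
      then show "cnj (round_amp j (b, enc (Suc j) (extend j ?q u b)) s) * round_amp j (b, enc (Suc j) (extend j ?q u b)) r
        = complex_of_real (wt (Suc j) (extend j ?q u b) / wt j ?q)"
        using enc(2)[OF _ ex[OF b]] j
        by (simp add: round_amp_def sw True[symmetric] abs_of_nonneg del: abs_divide of_real_divide flip: of_real_mult)
    qed
    also have "\<dots> = complex_of_real ((\<Sum>b\<in>B (Suc j). wt (Suc j) (extend j ?q u b)) / wt j ?q)"
      by (simp add: sum_divide_distrib)
    also have "(\<Sum>b\<in>B (Suc j). wt (Suc j) (extend j ?q u b)) = wt j ?q"
    proof -
      have "fst ?q \<in> PA j" "snd ?q \<in> PB j" using q by (auto simp: mem_Times_iff)
      from sum_weight_Suc[OF p j PiE_fun_upd_Suc[OF this(1) u] this(2)] restrict_fun_upd_Suc[OF this(1)]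
      show ?thesis by (simp add: extend_def)
    qed
    finally show ?thesis unfolding True[symmetric] sw by simp
  qed
qed

lemma round_quantum_op:
  assumes j: "j < n"
  defines "S \<equiv> {..<hdim j} \<times> A (Suc j)" and "T \<equiv> B (Suc j) \<times> {..<hdim (Suc j)}"
  shows "\<exists>\<Phi>. quantum_op S T \<Phi> \<and> (\<forall>\<psi> \<xi>. (\<forall>s\<in>S. wt j (dec j (fst s)) = 0 \<longrightarrow> \<psi> s = 0) \<longrightarrow>
    \<Phi> (\<lambda>s s'. \<psi> s * cnj (\<xi> s')) = (\<lambda>t t'. if t \<in> T \<and> t' \<in> T
       then (\<Sum>s\<in>S. round_amp j t s * \<psi> s) * cnj (\<Sum>s\<in>S. round_amp j t' s * \<xi> s) else 0))"
proof -
  have fin: "finite S" "finite T" using finA finB j by (auto simp: S_def T_def)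
  have "PB (Suc j) \<noteq> {}" using PB_nonempty j by simp
  then obtain y where "y \<in> PB (Suc j)" by blast
  then have "(y (Suc j), 0) \<in> T" using dim_pos[of "Suc j"] j by (auto simp: T_def)
  have gram: "(\<Sum>t\<in>T. cnj (round_amp j t s) * round_amp j t r)
    = (if s = r then if wt j (dec j (fst s)) \<noteq> 0 then 1 else 0 else 0)" if "s \<in> S" "r \<in> S" for s r
    using round_gram[OF j] that by (simp add: S_def T_def)
  have partial: "(\<Sum>r\<in>S. round_amp j t r * (\<Sum>t'\<in>T. cnj (round_amp j t' r) * round_amp j t' s)) = round_amp j t s"
    if s: "s \<in> S" for t s
  proof -
    have "(\<Sum>r\<in>S. round_amp j t r * (\<Sum>t'\<in>T. cnj (round_amp j t' r) * round_amp j t' s))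
      = (\<Sum>r\<in>S. if r = s then (if wt j (dec j (fst s)) \<noteq> 0 then round_amp j t s else 0) else 0)"
      by (intro sum.cong refl) (simp add: gram s)
    also have "\<dots> = (if wt j (dec j (fst s)) \<noteq> 0 then round_amp j t s else 0)"
      using fin s by simp
    also have "\<dots> = round_amp j t s"
      by (auto simp: round_amp_def split: prod.splits)
    finally show ?thesis .
  qed
  have "\<forall>t\<in>T. \<forall>s\<in>S. (\<Sum>r\<in>S. round_amp j t r * (\<Sum>t'\<in>T. cnj (round_amp j t' r) * round_amp j t' s)) = round_amp j t s"
    using partial by blast
  from partial_isometry_quantum_op[OF fin \<open>(y (Suc j), 0) \<in> T\<close> this]
  obtain \<Phi> where \<Phi>: "quantum_op S T \<Phi>"
    and act: "\<And>\<psi> \<xi>. \<forall>s\<in>S. (\<Sum>t\<in>T. cnj (round_amp j t s) * (\<Sum>r\<in>S. round_amp j t r * \<psi> r)) = \<psi> s \<Longrightarrow>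
         \<Phi> (\<lambda>s s'. \<psi> s * cnj (\<xi> s')) = (\<lambda>t t'. if t \<in> T \<and> t' \<in> T
           then (\<Sum>s\<in>S. round_amp j t s * \<psi> s) * cnj (\<Sum>s\<in>S. round_amp j t' s * \<xi> s) else 0)"
    by blast
  have "(\<Sum>t\<in>T. cnj (round_amp j t s) * (\<Sum>r\<in>S. round_amp j t r * \<psi> r)) = \<psi> s"
    if \<psi>: "\<forall>s\<in>S. wt j (dec j (fst s)) = 0 \<longrightarrow> \<psi> s = 0" and s: "s \<in> S" for \<psi> s
  proof -
    have "(\<Sum>t\<in>T. cnj (round_amp j t s) * (\<Sum>r\<in>S. round_amp j t r * \<psi> r))
      = (\<Sum>r\<in>S. (\<Sum>t\<in>T. cnj (round_amp j t s) * round_amp j t r) * \<psi> r)"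
      by (simp add: sum_distrib_left sum_distrib_right mult.assoc) (rule sum.swap)
    also have "\<dots> = (\<Sum>r\<in>S. if s = r then \<psi> s else 0)"
      using \<psi> s by (intro sum.cong refl) (auto simp: gram)
    also have "\<dots> = \<psi> s" using fin s by simp
    finally show ?thesis .
  qed
  then show ?thesis using \<Phi> act by (intro exI[of _ \<Phi>] conjI allI impI) simp_all
qed

text \<open>When the commitment is opened, Bob's record of \<open>x\<close> together with \<open>A'\<close> is, for given \<open>a\<close> and
  \<open>y\<close>, in the pure state \<open>\<Sum>\<^sub>x \<surd>(\<alpha>\<^sub>a(x) p\<^sub>n(x,y) / r\<^sub>a(y)) e\<^sub>x \<otimes> e\<^sub>x\<close>. Bob maps it to a fixed
  state and announces \<open>b = a \<oplus> c\<close> and \<open>y\<close>. As \<open>(b, y)\<close> determines \<open>(a, y)\<close>, the rows of this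
  amplitude matrix are orthogonal, and their norms are one or zero.\<close>

definition last_amp :: "(bit \<times> (nat \<Rightarrow> 'b)) \<times> nat \<Rightarrow> nat \<times> bit \<times> (nat \<Rightarrow> 'a) \<Rightarrow> complex" where
  "last_amp = (\<lambda>((b, y), _) (w, a, x). if b = a + c \<and> dec n w = (x, y)
     then complex_of_real (sqrt (\<alpha> a x * p n x y / red a y)) else 0)"

abbreviation "last_in \<equiv> {..<hdim n} \<times> (UNIV :: bit set) \<times> PA n"
abbreviation "last_out \<equiv> ((UNIV :: bit set) \<times> PB n) \<times> {..<1::nat}"

text \<open>The part of the joint state after round \<open>n\<close> in Bob's hands when Alice holds \<open>a0\<close> and \<open>y\<close>.\<close>

definition last_vec :: "bit \<Rightarrow> (nat \<Rightarrow> 'b) \<Rightarrow> nat \<times> bit \<times> (nat \<Rightarrow> 'a) \<Rightarrow> complex" where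
  "last_vec a0 y = (\<lambda>(w, a, x). if w < hdim n \<and> a = a0 \<and> dec n w = (x, y)
     then complex_of_real (sqrt (\<alpha> a x * p n x y / 2)) else 0)"

lemma finite_last: "finite last_in" "finite last_out"
  by (auto simp: finite_PA finite_PB)

lemma ap_nonneg: "x \<in> PA n \<Longrightarrow> y \<in> PB n \<Longrightarrow> 0 \<le> \<alpha> a x * p n x y"
  by (intro mult_nonneg_nonneg \<alpha>_nonneg polytope_nonneg[OF p])

lemma ap_zero: "x \<in> PA n \<Longrightarrow> y \<in> PB n \<Longrightarrow> red a y = 0 \<Longrightarrow> \<alpha> a x * p n x y = 0"
  unfolding reduced_vec_def using sum_nonneg_eq_0_iff[of "PA n" "\<lambda>x. \<alpha> a x * p n x y"] finite_PA ap_nonneg by auto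

lemma sum_last_in:
  assumes y: "y \<in> PB n"
    and supp: "\<And>w a x. f (w, a, x) \<noteq> 0 \<Longrightarrow> a = a0 \<and> dec n w = (x, y)"
  shows "(\<Sum>s\<in>last_in. f s) = (\<Sum>x\<in>PA n. f (enc n (x, y), a0, x))"
proof (rule sum_image_support[OF finite_last(1)])
  show "(\<lambda>x. (enc n (x, y), a0, x)) ` PA n \<subseteq> last_in"
    using y enc(1)[of n] by auto
  fix s assume s: "s \<in> last_in" "s \<notin> (\<lambda>x. (enc n (x, y), a0, x)) ` PA n"
  obtain w a x where wax: "s = (w, a, x)" by (cases s)
  have "\<not> (a = a0 \<and> dec n w = (x, y))"
  proof
    assume "a = a0 \<and> dec n w = (x, y)"
    moreover have "w = enc n (x, y)" if "dec n w = (x, y)"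
      using that s wax y enc[of n "(x, y)"] dec_eq_iff[of n w "enc n (x, y)"] by auto
    ultimately show False using s wax by auto
  qed
  then show "f s = 0" using supp wax by blast
qed (auto simp: inj_on_def)

lemma last_amp_vec:
  assumes y: "y \<in> PB n" and t: "t \<in> last_out"
  shows "(\<Sum>s\<in>last_in. last_amp t s * last_vec a0 y s)
    = (if fst t = (a0 + c, y) then complex_of_real (sqrt (red a0 y / 2)) else 0)"
proof -
  obtain b y' w' where byw: "t = ((b, y'), w')" using prod.collapse by metis
  have "(\<Sum>s\<in>last_in. last_amp t s * last_vec a0 y s)
    = (\<Sum>x\<in>PA n. last_amp t (enc n (x, y), a0, x) * last_vec a0 y (enc n (x, y), a0, x))"
    by (rule sum_last_in[OF y]) (auto simp: last_vec_def split: if_splits)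
  also have "\<dots> = (\<Sum>x\<in>PA n. if fst t = (a0 + c, y) then complex_of_real (\<alpha> a0 x * p n x y / (sqrt (red a0 y) * sqrt 2)) else 0)"
  proof (intro sum.cong refl)
    fix x assume x: "x \<in> PA n"
    have d: "dec n (enc n (x, y)) = (x, y)" "enc n (x, y) < hdim n"
      using enc[of n "(x, y)"] x y by simp_all
    have "sqrt (\<alpha> a0 x * p n x y / red a0 y) * sqrt (\<alpha> a0 x * p n x y / 2) = \<alpha> a0 x * p n x y / (sqrt (red a0 y) * sqrt 2)"
      using ap_nonneg[OF x y, of a0] by (simp add: real_sqrt_divide)
    then show "last_amp t (enc n (x, y), a0, x) * last_vec a0 y (enc n (x, y), a0, x)
      = (if fst t = (a0 + c, y) then complex_of_real (\<alpha> a0 x * p n x y / (sqrt (red a0 y) * sqrt 2)) else 0)"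
      by (auto simp: last_amp_def last_vec_def byw d simp del: of_real_divide of_real_mult simp flip: of_real_mult)
  qed
  also have "\<dots> = (if fst t = (a0 + c, y) then complex_of_real (red a0 y / (sqrt (red a0 y) * sqrt 2)) else 0)"
    by (auto simp: reduced_vec_def sum_divide_distrib)
  also have "red a0 y / (sqrt (red a0 y) * sqrt 2) = sqrt (red a0 y / 2)"
    using reduced_vec_nonneg[OF p y, of a0] by (simp add: real_sqrt_divide real_div_sqrt flip: divide_divide_eq_left)
  finally show ?thesis .
qed

lemma last_initial:
  assumes y: "y \<in> PB n" and s: "s \<in> last_in"
  shows "(\<Sum>t\<in>last_out. cnj (last_amp t s) * (\<Sum>r\<in>last_in. last_amp t r * last_vec a0 y r)) = last_vec a0 y s"
proof -
  obtain w a x where wax: "s = (w, a, x)" by (cases s)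
  have x: "x \<in> PA n" and w: "w < hdim n" using s wax by auto
  have "(\<Sum>t\<in>last_out. cnj (last_amp t s) * (\<Sum>r\<in>last_in. last_amp t r * last_vec a0 y r))
    = (\<Sum>t\<in>last_out. if t = ((a0 + c, y), 0) then cnj (last_amp t s) * complex_of_real (sqrt (red a0 y / 2)) else 0)"
    by (intro sum.cong refl) (auto simp: last_amp_vec[OF y])
  also have "\<dots> = cnj (last_amp ((a0 + c, y), 0) s) * complex_of_real (sqrt (red a0 y / 2))"
    using y finite_last by simp
  also have "\<dots> = last_vec a0 y s"
  proof -
    have "sqrt (\<alpha> a0 x * p n x y / red a0 y) * sqrt (red a0 y / 2) = sqrt (\<alpha> a0 x * p n x y / 2)"
      using ap_zero[OF x y, of a0] by (cases "red a0 y = 0") (simp_all flip: real_sqrt_mult)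
    then show ?thesis
      by (auto simp: last_amp_def last_vec_def wax w simp del: of_real_divide of_real_mult simp flip: of_real_mult)
  qed
  finally show ?thesis .
qed

lemma last_quantum_op:
  "\<exists>\<Phi>. quantum_op last_in last_out \<Phi> \<and> (\<forall>a y a' y'. y \<in> PB n \<longrightarrow> y' \<in> PB n \<longrightarrow>
    (\<forall>t\<in>last_out. \<forall>t'\<in>last_out. \<Phi> (\<lambda>s s'. last_vec a y s * cnj (last_vec a' y' s')) t t' =
       (if fst t = (a + c, y) then complex_of_real (sqrt (red a y / 2)) else 0) *
       (if fst t' = (a' + c, y') then complex_of_real (sqrt (red a' y' / 2)) else 0)))"
proof -
  obtain y0 where y0: "y0 \<in> PB n" using PB_nonempty by blast
  then have t0: "((0, y0), 0) \<in> last_out" by simp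
  have partial: "(\<Sum>r\<in>last_in. last_amp t r * (\<Sum>t'\<in>last_out. cnj (last_amp t' r) * last_amp t' s)) = last_amp t s"
    if t: "t \<in> last_out" and s: "s \<in> last_in" for t s
  proof -
    obtain b y w' where byw: "t = ((b, y), w')" using prod.collapse by metis
    obtain w a x where wax: "s = (w, a, x)" by (cases s)
    have y: "y \<in> PB n" using t byw by auto
    note b = bit_add_cancel[of b _ c]
    have row: "last_amp t' r * last_amp t r = 0" if "t' \<in> last_out" "t' \<noteq> t" for t' r
      using that t byw by (cases r) (auto simp: last_amp_def split: prod.splits)
    have "(\<Sum>r\<in>last_in. last_amp t r * (\<Sum>t'\<in>last_out. cnj (last_amp t' r) * last_amp t' s))
      = (\<Sum>r\<in>last_in. last_amp t r * (cnj (last_amp t r) * last_amp t s))"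
    proof (intro sum.cong refl)
      fix r
      have "(\<Sum>t'\<in>last_out. last_amp t r * (cnj (last_amp t' r) * last_amp t' s))
        = (\<Sum>t'\<in>last_out. if t' = t then last_amp t r * (cnj (last_amp t r) * last_amp t s) else 0)"
        using row[of _ r] by (intro sum.cong refl) auto
      then show "last_amp t r * (\<Sum>t'\<in>last_out. cnj (last_amp t' r) * last_amp t' s)
         = last_amp t r * (cnj (last_amp t r) * last_amp t s)"
        using t finite_last by (simp add: sum_distrib_left)
    qed
    also have "\<dots> = (\<Sum>r\<in>last_in. last_amp t r * cnj (last_amp t r)) * last_amp t s"
      by (simp add: sum_distrib_right mult.assoc)
    also have "(\<Sum>r\<in>last_in. last_amp t r * cnj (last_amp t r))
      = (\<Sum>x\<in>PA n. last_amp t (enc n (x, y), b + c, x) * cnj (last_amp t (enc n (x, y), b + c, x)))"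
      by (rule sum_last_in[OF y]) (auto simp: last_amp_def byw b split: if_splits)
    also have "\<dots> = (\<Sum>x\<in>PA n. complex_of_real (\<alpha> (b + c) x * p n x y / red (b + c) y))"
    proof (intro sum.cong refl)
      fix x assume x: "x \<in> PA n"
      have "0 \<le> \<alpha> (b + c) x * p n x y / red (b + c) y"
        by (intro divide_nonneg_nonneg ap_nonneg reduced_vec_nonneg[OF p] x y)
      then show "last_amp t (enc n (x, y), b + c, x) * cnj (last_amp t (enc n (x, y), b + c, x))
        = complex_of_real (\<alpha> (b + c) x * p n x y / red (b + c) y)"
        using enc(2)[of n "(x, y)"] x y
        by (simp add: last_amp_def byw b abs_of_nonneg del: abs_divide abs_mult of_real_divide of_real_mult flip: of_real_mult)
    qed
    also have "\<dots> = complex_of_real (red (b + c) y / red (b + c) y)"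
      unfolding reduced_vec_def sum_divide_distrib of_real_sum ..
    also have "\<dots> * last_amp t s = last_amp t s"
      by (auto simp: last_amp_def byw wax b)
    finally show ?thesis .
  qed
  have "\<forall>t\<in>last_out. \<forall>s\<in>last_in. (\<Sum>r\<in>last_in. last_amp t r * (\<Sum>t'\<in>last_out. cnj (last_amp t' r) * last_amp t' s)) = last_amp t s"
    using partial by blast
  from partial_isometry_quantum_op[OF finite_last t0 this]
  obtain \<Phi> where \<Phi>: "quantum_op last_in last_out \<Phi>"
    and act: "\<And>\<psi> \<xi>. \<forall>s\<in>last_in. (\<Sum>t\<in>last_out. cnj (last_amp t s) * (\<Sum>r\<in>last_in. last_amp t r * \<psi> r)) = \<psi> s \<Longrightarrow>
         \<Phi> (\<lambda>s s'. \<psi> s * cnj (\<xi> s')) = (\<lambda>t t'. if t \<in> last_out \<and> t' \<in> last_out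
           then (\<Sum>s\<in>last_in. last_amp t s * \<psi> s) * cnj (\<Sum>s\<in>last_in. last_amp t' s * \<xi> s) else 0)"
    by blast
  have act_vec: "\<Phi> (\<lambda>s s'. last_vec a y s * cnj (last_vec a' y' s')) t t' =
       (if fst t = (a + c, y) then complex_of_real (sqrt (red a y / 2)) else 0) *
       (if fst t' = (a' + c, y') then complex_of_real (sqrt (red a' y' / 2)) else 0)"
    if "y \<in> PB n" "y' \<in> PB n" "t \<in> last_out" "t' \<in> last_out" for a y a' y' t t'
  proof -
    have "\<forall>s\<in>last_in. (\<Sum>t\<in>last_out. cnj (last_amp t s) * (\<Sum>r\<in>last_in. last_amp t r * last_vec a y r)) = last_vec a y s"
      using last_initial[OF that(1)] by blast
    from act[OF this, of "last_vec a' y'"]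
    have "\<Phi> (\<lambda>s s'. last_vec a y s * cnj (last_vec a' y' s')) t t'
      = (\<Sum>s\<in>last_in. last_amp t s * last_vec a y s) * cnj (\<Sum>s\<in>last_in. last_amp t' s * last_vec a' y' s)"
      by (rule trans[OF fun_cong[OF fun_cong]]) (use that in simp)
    moreover have "cnj (if P then complex_of_real r else 0) = (if P then complex_of_real r else 0)" for P r
      by simp
    ultimately show ?thesis
      unfolding last_amp_vec[OF that(1,3)] last_amp_vec[OF that(2,4)] by (rule trans[OF _ arg_cong])
  qed
  show ?thesis
    by (rule exI[of _ \<Phi>], intro conjI allI impI ballI, rule \<Phi>, rule act_vec)
qed

end

context cheating_strategy
begin

text \<open>The joint state after round \<open>j\<close> under this strategy.\<close>

definition state_vec ::
  "nat \<Rightarrow> (bit \<times> bit \<times> (nat \<Rightarrow> 'a) \<times> (nat \<Rightarrow> 'a) \<times> (nat \<Rightarrow> 'b)) \<times> nat \<Rightarrow> complex" where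
  "state_vec j = (\<lambda>((a0, a0', x, x', y), w).
     if (a0, a0', x, x', y) \<in> regs j j \<and> a0 = a0' \<and> x = restrict x' {j<..n} \<and>
        w < hdim j \<and> dec j w = (restrict x' {1..j}, y)
     then complex_of_real (sqrt (\<alpha> a0 x' * weight p j (restrict x' {1..j}) y / 2)) else 0)"

text \<open>For given registers of Alice, Bob's part of the joint state once message \<open>j + 1\<close> has
  reached him.\<close>

definition sent_vec ::
  "nat \<Rightarrow> bit \<times> bit \<times> (nat \<Rightarrow> 'a) \<times> (nat \<Rightarrow> 'a) \<times> (nat \<Rightarrow> 'b) \<Rightarrow> nat \<times> 'a \<Rightarrow> complex" where
  "sent_vec j = (\<lambda>(a0, a0', x, x', y) (w, u).
     if (a0, a0', x, x', y) \<in> regs (Suc j) j \<and> w < hdim j \<and> u \<in> A (Suc j)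
     then state_vec j ((a0, a0', x(Suc j := u), x', y), w) else 0)"

lemma sent_vec_support:
  assumes "j < n" "(a0, a0', x, x', y) \<in> regs (Suc j) j" "sent_vec j (a0, a0', x, x', y) (w, u) \<noteq> 0"
  shows "a0 = a0' \<and> x = restrict x' {Suc j<..n} \<and> u = x' (Suc j) \<and> w < hdim j \<and> dec j w = (restrict x' {1..j}, y)"
proof -
  have "x \<in> Pi\<^sub>E {Suc j<..n} A" using assms(2) by (simp add: alice_regs_def)
  from fun_upd_eq_restrict_iff[OF this, of u x'] assms show ?thesis
    by (simp add: sent_vec_def state_vec_def split: if_splits)
qed

text \<open>Exactly one input of Bob's operation contributes to each entry, and the new amplitude
  \<open>\<surd>(p\<^bsub>j+1\<^esub> / p\<^sub>j)\<close> cancels the root of \<open>p\<^sub>j\<close> in the old one.\<close>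

lemma state_vec_Suc:
  assumes j: "j < n" and e: "(a0, a0', x, x', y) \<in> regs (Suc j) (Suc j)" and w': "w' < hdim (Suc j)"
  shows "(\<Sum>s\<in>{..<hdim j} \<times> A (Suc j). round_amp j (y (Suc j), w') s * sent_vec j (a0, a0', x, x', restrict y {1..j}) s)
    = state_vec (Suc j) ((a0, a0', x, x', y), w')"
proof -
  define y0 where "y0 = restrict y {1..j}"
  define q where "q = (restrict x' {1..j}, y0)"
  let ?f = "\<lambda>s. round_amp j (y (Suc j), w') s * sent_vec j (a0, a0', x, x', y0) s"
  have x: "x \<in> Pi\<^sub>E {Suc j<..n} A" and x': "x' \<in> PA n" and y: "y \<in> PB (Suc j)"
    using e by (simp_all add: alice_regs_def)
  have y0: "y0 \<in> PB j" unfolding y0_def by (rule PiE_restrict[OF y]) simp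
  have x'j: "restrict x' {1..j} \<in> PA j" by (rule PiE_restrict[OF x']) (use j in simp)
  have x'S: "restrict x' {1..Suc j} \<in> PA (Suc j)" by (rule PiE_restrict[OF x']) (use j in simp)
  have q: "q \<in> hist j" using y0 x'j by (simp add: q_def)
  have e0: "(a0, a0', x, x', y0) \<in> regs (Suc j) j" using x x' y0 by (simp add: alice_regs_def)
  have u0: "x' (Suc j) \<in> A (Suc j)" using PiE_mem[OF x', of "Suc j"] j by simp
  have ext: "extend j q (x' (Suc j)) (y (Suc j)) = (restrict x' {1..Suc j}, y)"
    using restrict_fun_upd_same[OF y] by (auto simp: extend_def q_def y0_def fun_eq_iff)
  show ?thesis
  proof (cases "a0 = a0' \<and> x = restrict x' {Suc j<..n}")
    case False
    have "sent_vec j (a0, a0', x, x', y0) s = 0" for s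
      using sent_vec_support[OF j e0, of "fst s" "snd s"] False by (cases s) auto
    then have "(\<Sum>s\<in>{..<hdim j} \<times> A (Suc j). ?f s) = 0" by simp
    moreover have "state_vec (Suc j) ((a0, a0', x, x', y), w') = 0"
      using False by (auto simp: state_vec_def)
    ultimately show ?thesis by (simp add: y0_def)
  next
    case True
    let ?s0 = "(enc j q, x' (Suc j))"
    have s0: "?s0 \<in> {..<hdim j} \<times> A (Suc j)" using enc(1)[OF _ q] u0 j by simp
    have "(\<Sum>s\<in>{..<hdim j} \<times> A (Suc j). ?f s) = (\<Sum>s\<in>{?s0}. ?f s)"
    proof (rule sum.mono_neutral_right)
      show "finite ({..<hdim j} \<times> A (Suc j))" using finA[of "Suc j"] j by simp
      show "{?s0} \<subseteq> {..<hdim j} \<times> A (Suc j)" using s0 by simp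
      show "\<forall>s\<in>{..<hdim j} \<times> A (Suc j) - {?s0}. ?f s = 0"
      proof
        fix s assume s: "s \<in> {..<hdim j} \<times> A (Suc j) - {?s0}"
        obtain w u where wu: "s = (w, u)" by (cases s)
        have "sent_vec j (a0, a0', x, x', y0) (w, u) = 0"
        proof (rule ccontr)
          assume "sent_vec j (a0, a0', x, x', y0) (w, u) \<noteq> 0"
          from sent_vec_support[OF j e0 this] have "u = x' (Suc j)" "w < hdim j" "dec j w = q"
            by (auto simp: q_def)
          moreover have "w = enc j q"
            using dec_eq_iff[of j w "enc j q"] enc[OF _ q] calculation j by simp
          ultimately show False using s wu by simp
        qed
        then show "?f s = 0" by (simp add: wu)
      qed
    qed
    also have "\<dots> = round_amp j (y (Suc j), w') ?s0 * sent_vec j (a0, a0', x, x', y0) ?s0" by simp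
    also have "sent_vec j (a0, a0', x, x', y0) ?s0
        = complex_of_real (sqrt (\<alpha> a0 x' * weight p j (restrict x' {1..j}) y0 / 2))"
    proof -
      have "x(Suc j := x' (Suc j)) = restrict x' {j<..n}"
        using fun_upd_eq_restrict_iff[OF x, of "x' (Suc j)" x'] True j by simp
      moreover have "(a0, a0', restrict x' {j<..n}, x', y0) \<in> regs j j"
        using x' y0 by (auto simp: alice_regs_def)
      ultimately show ?thesis
        using e0 s0 True enc[OF _ q] j by (simp add: sent_vec_def state_vec_def q_def)
    qed
    also have "round_amp j (y (Suc j), w') ?s0 = (if dec (Suc j) w' = (restrict x' {1..Suc j}, y)
        then complex_of_real (sqrt (weight p (Suc j) (restrict x' {1..Suc j}) y / weight p j (restrict x' {1..j}) y0)) else 0)"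
      using enc(2)[OF _ q] j by (simp add: round_amp_def ext) (simp add: q_def)
    also have "\<dots> * complex_of_real (sqrt (\<alpha> a0 x' * weight p j (restrict x' {1..j}) y0 / 2))
        = state_vec (Suc j) ((a0, a0', x, x', y), w')"
    proof -
      let ?W' = "weight p (Suc j) (restrict x' {1..Suc j}) y" and ?W = "weight p j (restrict x' {1..j}) y0"
      have "restrict (restrict x' {1..Suc j}) {1..j} = restrict x' {1..j}" by (auto simp: fun_eq_iff)
      then have "?W' \<le> ?W" using wt_Suc_le[OF j x'S y] by (simp add: y0_def)
      moreover have "0 \<le> ?W'" using wt_nonneg[of "Suc j" "(restrict x' {1..Suc j}, y)"] x'S y j by simp
      \<comment> \<open>Where \<open>p\<^sub>j\<close> vanishes, the quotient is zero and so is \<open>p\<^bsub>j+1\<^esub>\<close>.\<close>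
      ultimately have "?W' = 0" if "?W = 0" using that by simp
      then have "sqrt (?W' / ?W) * sqrt (\<alpha> a0 x' * ?W / 2) = sqrt (\<alpha> a0 x' * ?W' / 2)"
        by (cases "?W = 0") (simp_all add: mult.commute flip: real_sqrt_mult)
      then show ?thesis using True e w'
        by (simp add: state_vec_def flip: of_real_mult)
    qed
    finally show ?thesis unfolding y0_def .
  qed
qed

lemma hist_0: "hist 0 = {(\<lambda>_. undefined, \<lambda>_. undefined)}"
  by auto

lemma optimal_strategy: "\<exists>s. valid_strategy n A B s \<and> accept_prob n A B \<alpha> \<beta> c s = objective p"
proof -
  let ?S = "\<lambda>j. {..<hdim j} \<times> A (Suc j)" and ?T = "\<lambda>j. B (Suc j) \<times> {..<hdim (Suc j)}"
  let ?V = "\<lambda>j \<psi> t. \<Sum>s\<in>?S j. round_amp j t s * \<psi> s"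
  obtain R where R: "\<And>j. j < n \<Longrightarrow> quantum_op (?S j) (?T j) (R j)"
    and R_act: "\<And>j \<psi> \<xi>. j < n \<Longrightarrow> \<forall>s\<in>?S j. wt j (dec j (fst s)) = 0 \<longrightarrow> \<psi> s = 0 \<Longrightarrow>
      R j (\<lambda>s s'. \<psi> s * cnj (\<xi> s')) = (\<lambda>t t'. if t \<in> ?T j \<and> t' \<in> ?T j then ?V j \<psi> t * cnj (?V j \<xi> t') else 0)"
  proof -
    have "\<exists>R. \<forall>j\<in>{..<n}. quantum_op (?S j) (?T j) (R j) \<and>
      (\<forall>\<psi> \<xi>. (\<forall>s\<in>?S j. wt j (dec j (fst s)) = 0 \<longrightarrow> \<psi> s = 0) \<longrightarrow>
      R j (\<lambda>s s'. \<psi> s * cnj (\<xi> s')) = (\<lambda>t t'. if t \<in> ?T j \<and> t' \<in> ?T j then ?V j \<psi> t * cnj (?V j \<xi> t') else 0))"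
      by (rule bchoice) (use round_quantum_op in simp)
    then obtain R where R: "\<forall>j\<in>{..<n}. quantum_op (?S j) (?T j) (R j) \<and>
      (\<forall>\<psi> \<xi>. (\<forall>s\<in>?S j. wt j (dec j (fst s)) = 0 \<longrightarrow> \<psi> s = 0) \<longrightarrow>
      R j (\<lambda>s s'. \<psi> s * cnj (\<xi> s')) = (\<lambda>t t'. if t \<in> ?T j \<and> t' \<in> ?T j then ?V j \<psi> t * cnj (?V j \<xi> t') else 0))" ..
    show thesis
    proof (rule that)
      fix j assume "j < n"
      then show "quantum_op (?S j) (?T j) (R j)" using R by simp
    next
      fix j and \<psi> \<xi> :: "nat \<times> 'a \<Rightarrow> complex"
      assume "j < n" "\<forall>s\<in>?S j. wt j (dec j (fst s)) = 0 \<longrightarrow> \<psi> s = 0"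
      then show "R j (\<lambda>s s'. \<psi> s * cnj (\<xi> s')) = (\<lambda>t t'. if t \<in> ?T j \<and> t' \<in> ?T j then ?V j \<psi> t * cnj (?V j \<xi> t') else 0)"
        by (intro R[THEN bspec, THEN conjunct2, THEN spec, THEN spec, THEN mp]) (simp_all only: lessThan_iff)
    qed
  qed
  obtain L where L: "quantum_op last_in last_out L"
    and L_act: "\<And>a y a' y' t t'. y \<in> PB n \<Longrightarrow> y' \<in> PB n \<Longrightarrow> t \<in> last_out \<Longrightarrow> t' \<in> last_out \<Longrightarrow>
      L (\<lambda>s s'. last_vec a y s * cnj (last_vec a' y' s')) t t' =
       (if fst t = (a + c, y) then complex_of_real (sqrt (red a y / 2)) else 0) *
       (if fst t' = (a' + c, y') then complex_of_real (sqrt (red a' y' / 2)) else 0)"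
    using last_quantum_op by (elim exE conjE) metis
  define s :: "('a, 'b) bob_strategy" where
    "s = \<lparr>wdim = (\<lambda>j. if j \<le> n then hdim j else 1), init_state = outer (basis_vec 0),
      round_op = (\<lambda>j. R (j - 1)), last_op = L, num_outcomes = 1, final_meas = (\<lambda>_. id_mat {..<1})\<rparr>"
  have W: "wspace s j = {..<hdim j}" if "j \<le> n" for j using that by (simp add: s_def)
  have W_last: "wspace s (n + 1) = {..<1}" by (simp add: s_def)
  have hdim_0: "hdim 0 = 1" unfolding hist_0 by simp
  have init: "density_on {..<1} (init_state s)"
  proof -
    have "psd_on ({..<1::nat} \<times> {()}) (tensor (outer (basis_vec 0)) (\<lambda>_ _. 1))"
      by (rule psd_on_tensor_outer) (auto simp: psd_on_def mats_def basis_vec_def complex_nonneg_Reals_iff)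
    then have "psd_on {..<1} (relabel {..<1::nat} (\<lambda>w. (w, ())) (tensor (outer (basis_vec 0)) (\<lambda>_ _. 1)))"
      by (rule psd_on_relabel) auto
    also have "relabel {..<1::nat} (\<lambda>w. (w, ())) (tensor (outer (basis_vec 0)) (\<lambda>_ _. 1)) = init_state s"
      by (auto simp: s_def relabel_def tensor_def outer_def basis_vec_def fun_eq_iff)
    finally show ?thesis by (simp add: density_on_def trace_on_def s_def outer_def basis_vec_def)
  qed
  have povm: "povm (wspace s (n + 1)) (num_outcomes s) (final_meas s)"
    unfolding povm_def W_last by (simp add: s_def psd_on_id_mat)
  have valid: "valid_strategy n A B s"
    unfolding valid_strategy_def
  proof (intro conjI ballI)
    show "density_on (wspace s 0) (init_state s)" unfolding W[OF le0] hdim_0 by (rule init)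
    show "povm (wspace s (n + 1)) (num_outcomes s) (final_meas s)" by (rule povm)
    show "quantum_op (wspace s n \<times> UNIV \<times> PA n) ((UNIV \<times> PB n) \<times> wspace s (n + 1)) (last_op s)"
      using L unfolding W[OF order.refl] W_last by (simp add: s_def)
    fix j assume "j \<in> {1..n}"
    then obtain i where i: "j = Suc i" "i < n" by (cases j) auto
    then show "quantum_op (wspace s (j - 1) \<times> A j) (B j \<times> wspace s j) (round_op s j)"
      using R[of i] W[of i] W[of "Suc i"] by (simp add: s_def)
  qed
  have joint: "joint_state n A B \<alpha> s j = outer (state_vec j)" if "j \<le> n" for j
    using that
  proof (induction j)
    case 0
    have "joint_state n A B \<alpha> s 0 = outer (\<lambda>((a0, a0', x, x', y), w).
      (if (a0, a0', x, x', y) \<in> regs 0 0 then alice_psi n A \<alpha> (a0, a0', x, x') else 0) * basis_vec 0 w)"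
      by (auto simp: s_def tensor_def relabel_def outer_def fun_eq_iff)
    also have "(\<lambda>((a0, a0', x, x', y), w).
      (if (a0, a0', x, x', y) \<in> regs 0 0 then alice_psi n A \<alpha> (a0, a0', x, x') else 0) * basis_vec 0 w) = state_vec 0"
    proof (intro ext, clarify)
      fix a0 a0' x x' y and w :: nat
      have eq: "{0<..n} = {1..n}" by auto
      have dec0: "dec 0 0 = (\<lambda>_. undefined, \<lambda>_. undefined)"
        using dec_hist[of 0 0] hdim_0 unfolding hist_0 by simp
      show "(if (a0, a0', x, x', y) \<in> regs 0 0 then alice_psi n A \<alpha> (a0, a0', x, x') else 0) * basis_vec 0 w
        = state_vec 0 ((a0, a0', x, x', y), w)"
      proof (cases "(a0, a0', x, x', y) \<in> regs 0 0")
        case True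
        then have x: "x \<in> PA n" "x' \<in> PA n" and y: "y = (\<lambda>_. undefined)"
          unfolding alice_regs_def eq by auto
        have x'r: "restrict x' {1..n} = x'" using x by (auto simp: PiE_def extensional_restrict)
        show ?thesis
          using True x y x'r hdim_0 dec0
          by (auto simp: state_vec_def alice_psi_apply basis_vec_def eq weight_def real_sqrt_divide)
      next
        case False
        then show ?thesis by (simp add: state_vec_def)
      qed
    qed
    finally show ?case .
  next
    case (Suc j)
    then have j: "j < n" by simp
    define sent where "sent = relabel (regs (Suc j) j \<times> wspace s j \<times> A (Suc j))
                   (\<lambda>((a0, a0', x, x', y), (w, u)). ((a0, a0', x(Suc j := u), x', y), w)) (joint_state n A B \<alpha> s j)"
    have sent: "(\<lambda>t t'. sent (e, t) (e', t')) = (\<lambda>t t'. sent_vec j e t * cnj (sent_vec j e' t'))" for e e'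
      using Suc j unfolding sent_def W[OF less_imp_le[OF j]]
      by (cases e rule: prod_cases5; cases e' rule: prod_cases5)
        (auto simp: relabel_def outer_def sent_vec_def fun_eq_iff)
    have supp: "\<forall>t\<in>?S j. wt j (dec j (fst t)) = 0 \<longrightarrow> sent_vec j e t = 0" for e
    proof (intro ballI impI)
      fix t :: "nat \<times> 'a" assume t: "wt j (dec j (fst t)) = 0"
      obtain a0 a0' x x' y w u where *: "e = (a0, a0', x, x', y)" "t = (w, u)" by (cases e, cases t)
      have "state_vec j ((a0, a0', z, x', y), w) = 0" for z
        using t * by (auto simp: state_vec_def)
      then show "sent_vec j e t = 0" by (simp add: sent_vec_def *)
    qed
    have amp: "ampliate (round_op s (Suc j)) sent (e, t) (e', t')
      = ?V j (sent_vec j e) t * cnj (?V j (sent_vec j e') t')" if "t \<in> ?T j" "t' \<in> ?T j" for e e' t t'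
    proof -
      have "ampliate (round_op s (Suc j)) sent (e, t) (e', t')
        = R j (\<lambda>t t'. sent_vec j e t * cnj (sent_vec j e' t')) t t'"
        by (simp add: ampliate_def sent) (simp add: s_def)
      also have "\<dots> = ?V j (sent_vec j e) t * cnj (?V j (sent_vec j e') t')"
        unfolding R_act[OF j supp] using that by simp
      finally show ?thesis .
    qed
    show ?case
    proof (intro ext)
      fix k l :: "(bit \<times> bit \<times> (nat \<Rightarrow> 'a) \<times> (nat \<Rightarrow> 'a) \<times> (nat \<Rightarrow> 'b)) \<times> nat"
      obtain a0 a0' x x' y w where k: "k = ((a0, a0', x, x', y), w)" by (metis prod.collapse)
      obtain b0 b0' z z' v u where l: "l = ((b0, b0', z, z', v), u)" by (metis prod.collapse)
      let ?D = "regs (Suc j) (Suc j) \<times> {..<hdim (Suc j)}"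
      show "joint_state n A B \<alpha> s (Suc j) k l = outer (state_vec (Suc j)) k l"
      proof (cases "k \<in> ?D \<and> l \<in> ?D")
        case True
        then have e: "(a0, a0', x, x', y) \<in> regs (Suc j) (Suc j)" "w < hdim (Suc j)"
          "(b0, b0', z, z', v) \<in> regs (Suc j) (Suc j)" "u < hdim (Suc j)"
          by (simp_all add: k l)
        then have t: "(y (Suc j), w) \<in> ?T j" "(v (Suc j), u) \<in> ?T j"
          by (auto simp: alice_regs_def)
        have "joint_state n A B \<alpha> s (Suc j) k l
          = ampliate (round_op s (Suc j)) sent ((a0, a0', x, x', restrict y {1..j}), (y (Suc j), w))
             ((b0, b0', z, z', restrict v {1..j}), (v (Suc j), u))"
          unfolding joint_state.simps Let_def sent_def[symmetric]
          unfolding W[OF Suc.prems] relabel_def using True by (simp add: k l)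
        also have "\<dots> = outer (state_vec (Suc j)) k l"
          unfolding amp[OF t] state_vec_Suc[OF j e(1,2)] state_vec_Suc[OF j e(3,4)] by (simp add: k l outer_def)
        finally show ?thesis .
      next
        case False
        then have "state_vec (Suc j) k = 0 \<or> state_vec (Suc j) l = 0"
          by (auto simp: state_vec_def k l)
        moreover have "joint_state n A B \<alpha> s (Suc j) k l = 0"
          unfolding joint_state.simps Let_def sent_def[symmetric]
          unfolding W[OF Suc.prems] relabel_def using False by (rule if_not_P)
        ultimately show ?thesis by (auto simp: outer_def simp del: joint_state.simps)
      qed
    qed
  qed
  have final: "final_state n A B \<alpha> s ((b + c, b, y, y), 0) ((b + c, b, y', y'), 0)
    = complex_of_real (sqrt (red (b + c) y / 2) * sqrt (red (b + c) y' / 2))"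
    if y: "y \<in> PB n" "y' \<in> PB n" for b y y'
  proof -
    define sent where "sent = relabel ((UNIV \<times> PB n) \<times> wspace s n \<times> UNIV \<times> PA n)
                   (\<lambda>((a0, y), (w, a0', x')). ((a0, a0', \<lambda>_. undefined, x', y), w))
                   (joint_state n A B \<alpha> s n)"
    have vec: "state_vec n ((a0, a0', \<lambda>_. undefined, x', y), w) = last_vec a0 y (w, a0', x')"
      if "x' \<in> PA n" "y \<in> PB n" for a0 a0' x' y w
    proof -
      have 1: "restrict x' {n<..n} = (\<lambda>_. undefined)" by auto
      have 2: "restrict x' {1..n} = x'" using that by (auto simp: PiE_def extensional_restrict)
      show ?thesis using that 1 2 by (auto simp: state_vec_def last_vec_def alice_regs_def weight_n)
    qed
    have zero: "last_vec a0 y t = 0" if "t \<notin> last_in" for a0 y t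
    proof -
      obtain w a x where t: "t = (w, a, x)" by (cases t)
      show ?thesis
        by (cases "w < hdim n \<and> dec n w = (x, y)")
          (use dec_hist[of n w] that in \<open>auto simp add: last_vec_def t simp del: PiE_iff del: PiE_I\<close>)
    qed
    have sent: "(\<lambda>t t'. sent ((a0, y), t) ((a0', y'), t')) = (\<lambda>t t'. last_vec a0 y t * cnj (last_vec a0' y' t'))"
      if "y \<in> PB n" "y' \<in> PB n" for a0 a0' y y'
    proof (intro ext)
      fix t t'
      show "sent ((a0, y), t) ((a0', y'), t') = last_vec a0 y t * cnj (last_vec a0' y' t')"
      proof (cases "t \<in> last_in \<and> t' \<in> last_in")
        case True
        then show ?thesis using that unfolding sent_def W[OF order.refl] joint[OF order.refl]
          by (cases t; cases t') (simp add: relabel_def outer_def vec)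
      next
        case False
        then have "sent ((a0, y), t) ((a0', y'), t') = 0"
          unfolding sent_def W[OF order.refl] relabel_def by (intro if_not_P) blast
        moreover have "last_vec a0 y t = 0 \<or> last_vec a0' y' t' = 0" using False zero by blast
        ultimately show ?thesis by auto
      qed
    qed
    have "final_state n A B \<alpha> s ((b + c, b, y, y), 0) ((b + c, b, y', y'), 0)
      = L (\<lambda>t t'. last_vec (b + c) y t * cnj (last_vec (b + c) y' t')) ((b, y), 0) ((b, y'), 0)"
      unfolding final_state_def Let_def sent_def[symmetric] W_last using y
      by (simp add: relabel_def final_regs_def ampliate_def sent) (simp add: s_def)
    also have "\<dots> = complex_of_real (sqrt (red (b + c) y / 2) * sqrt (red (b + c) y' / 2))"
      using y bit_add_cancel[of b "b + c" c] by (subst L_act) auto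
    finally show ?thesis .
  qed
  have "accept_prob n A B \<alpha> \<beta> c s = (\<Sum>b\<in>UNIV. \<Sum>y\<in>PB n. \<Sum>y'\<in>PB n. sqrt (\<beta> b y) * sqrt (\<beta> b y') *
       (sqrt (red (b + c) y / 2) * sqrt (red (b + c) y' / 2)))"
    unfolding accept_prob_eq[OF povm] W_last by (intro sum.cong refl) (simp add: final)
  also have "\<dots> = (\<Sum>b\<in>UNIV. fidelity (PB n) (\<lambda>y. 1 / 2 * red (b + c) y) (\<beta> b))"
    by (simp add: fidelity_def power2_eq_square sum_product mult_ac)
  also have "\<dots> = objective p"
    unfolding objective_eq sum_distrib_left by (intro sum.cong refl fidelity_scale) simp
  finally show ?thesis using valid by blast
qed

end

context coin_flipping
begin

lemma strategy_attaining_objective: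
  assumes "p \<in> cheats"
  shows "\<exists>s. valid_strategy n A B s \<and> accept_prob n A B \<alpha> \<beta> c s = objective p"
proof -
  have "\<exists>d. \<forall>j\<in>{..n}. bij_betw (d j) {..<hdim j} (hist j)"
    by (rule bchoice) (use ex_bij_betw_nat_finite[OF finite_hist] in \<open>simp add: atLeast0LessThan\<close>)
  then obtain d where "\<And>j. j \<le> n \<Longrightarrow> bij_betw (d j) {..<hdim j} (hist j)" by auto
  then interpret cheating_strategy n A B \<alpha> \<beta> c p d
    using assms by unfold_locales auto
  show ?thesis by (rule optimal_strategy)
qed

end

theorem theorem4p4:
  fixes n :: nat
    and A :: "nat \<Rightarrow> 'a set" and B :: "nat \<Rightarrow> 'b set"
    and \<alpha> :: "bit \<Rightarrow> (nat \<Rightarrow> 'a) \<Rightarrow> real" and \<beta> :: "bit \<Rightarrow> (nat \<Rightarrow> 'b) \<Rightarrow> real"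
    and c :: bit
  assumes "n \<ge> 1"
    and "\<And>i. i \<in> {1..n} \<Longrightarrow> finite (A i)"
    and "\<And>i. i \<in> {1..n} \<Longrightarrow> finite (B i)"
    and "\<And>a. prob_vec (Pi\<^sub>E {1..n} A) (\<alpha> a)"
    and "\<And>b. prob_vec (Pi\<^sub>E {1..n} B) (\<beta> b)"
  shows "(\<exists>p\<in>bob_polytope n A B. bob_objective n A B \<alpha> \<beta> c p = bob_cheat_prob n A B \<alpha> \<beta> c) \<and>
    (\<forall>p\<in>bob_polytope n A B. bob_objective n A B \<alpha> \<beta> c p \<le> bob_cheat_prob n A B \<alpha> \<beta> c) \<and>
    convex_maximization (bob_polytope n A B) (bob_objective n A B \<alpha> \<beta> c) \<and>
    (\<forall>p\<in>bob_polytope n A B. \<forall>a. prob_vec (Pi\<^sub>E {1..n} B) (reduced_vec n A (\<alpha> a) p) \<and>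
       prob_vec (Pi\<^sub>E {1..n} B) (\<beta> (a + c)))"
proof -
  interpret coin_flipping n A B \<alpha> \<beta> c
    using assms by unfold_locales
  obtain p where p: "p \<in> cheats" and max: "\<And>q. q \<in> cheats \<Longrightarrow> objective q \<le> objective p"
    using objective_attains_max by blast
  have upper: "accept_prob n A B \<alpha> \<beta> c s \<le> objective p" if "valid_strategy n A B s" for s
    using accept_prob_le_objective[OF that] max[OF bob_weight_in_polytope[OF that]] by simp
  obtain s where s: "valid_strategy n A B s" "accept_prob n A B \<alpha> \<beta> c s = objective p"
    using strategy_attaining_objective[OF p] by blast
  have "bob_cheat_prob n A B \<alpha> \<beta> c = objective p"
    unfolding bob_cheat_prob_def
  proof (rule cSup_eq_maximum)
    show "objective p \<in> accept_prob n A B \<alpha> \<beta> c ` {s. valid_strategy n A B s}"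
      using s by (metis image_eqI mem_Collect_eq)
  qed (use upper in auto)
  then show ?thesis
    using p max convex_maximization_polytope prob_vec_reduced prob_\<beta> by auto
qed

end
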